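(* Let $B\subseteq\mathbb R^d_\xi$ be a connected open set and $f$ an analytic function on $B+i\mathbb R^d_\eta$ such that, in the Beurling case $*=(M_p)$: for every compact $K\subset B$ there exist $C>0$ and $k>0$, resp. in the Roumieu case $*=\{M_p\}$: for every compact $K\subset B$ and every $k>0$ there exists $C>0$, with $$|f(\xi+i\eta)|\le Ce^{M(k|\eta|)}\quad\text{for all }\xi\in K,\ \eta\in\mathbb R^d.$$ Then there exists $S\in\mathcal D'^{*}(\mathbb R^d_x)$ such that $e^{-x\xi}S(x)\in\mathcal S'^{*}(\mathbb R^d_x)$ for all $\xi\in B$ and $$\mathcal F_{x\to\eta}\big(e^{-x\xi}S(x)\big)(\eta)=f(\xi+i\eta)\quad\text{for all }\xi\in B,\ \eta\in\mathbb R^d.$$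
   Context: $M_p$ ($p\in\mathbb N$) is a sequence of positive numbers with $M_0=1$ satisfying (M.1) $M_p^2\le M_{p-1}M_{p+1}$; (M.2) $M_p\le c_0H^p\min_{0\le q\le p}M_{p-q}M_q$ for some $c_0,H\ge1$; (M.3) $\sum_{p=q+1}^\infty M_{p-1}/M_p\le c_0 q M_q/M_{q+1}$. $M(\rho)=\sup_{p}\log_+(\rho^p/M_p)$. The symbol $*$ stands for either $(M_p)$ (Beurling) or $\{M_p\}$ (Roumieu). $\mathcal D'^{*}$ denotes Komatsu's ultradistributions of Beurling resp. Roumieu type. For $m>0$, $\sigma_{m,\infty}(\varphi)=\sup_{\alpha,\beta}\sup_x m^{|\alpha|+|\beta|}\langle x\rangle^{|\beta|}|D^\alpha\varphi(x)|/(M_{|\alpha|}M_{|\beta|})$, $\langle x\rangle=(1+|x|^2)^{1/2}$; $\mathcal S^{(M_p)}=\varprojlim_{m\to\infty}\mathcal S^{M_p,m}_\infty$, $\mathcal S^{\{M_p\}}=\varinjlim_{m\to0}\mathcal S^{M_p,m}_\infty$ with $\mathcal S^{M_p,m}_\infty=\{\varphi\in C^\infty:\sigma_{m,\infty}(\varphi)<\infty\}$; $\mathcal S'^{*}$ is the strong dual. $\mathcal F f(\eta)=\int e^{-ix\eta}f(x)dx$, extended to $\mathcal S'^{*}$. *)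

theory Defs
  imports "HOL-Analysis.Analysis"
begin

definition weight_seq :: "(nat \<Rightarrow> real) \<Rightarrow> bool" where
  "weight_seq M \<longleftrightarrow>
     M 0 = 1 \<and> (\<forall>p. M p > 0) \<and>
     (\<forall>p\<ge>1. (M p)\<^sup>2 \<le> M (p - 1) * M (p + 1)) \<and>
     (\<exists>c0 H::real. c0 \<ge> 1 \<and> H \<ge> 1 \<and>
        (\<forall>p q. q \<le> p \<longrightarrow> M p \<le> c0 * H ^ p * (M (p - q) * M q)) \<and>
        summable (\<lambda>p. M p / M (Suc p)) \<and>
        (\<forall>q\<ge>1. (\<Sum>k. M (q + k) / M (q + k + 1)) \<le> c0 * real q * M q / M (q + 1)))"

definition assoc_fun :: "(nat \<Rightarrow> real) \<Rightarrow> real \<Rightarrow> real" where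
  "assoc_fun M \<rho> = (SUP p. max 0 (ln (\<rho> ^ p / M p)))"

type_synonym 'n multi_index = "'n \<Rightarrow> nat"

definition mi_len :: "('n::finite) multi_index \<Rightarrow> nat" where
  "mi_len \<alpha> = (\<Sum>i\<in>UNIV. \<alpha> i)"

definition smooth_family ::
  "(real^'n::finite \<Rightarrow> complex) \<Rightarrow> ('n multi_index \<Rightarrow> real^'n \<Rightarrow> complex) \<Rightarrow> bool" where
  "smooth_family \<phi> \<Phi> \<longleftrightarrow>
     \<Phi> (\<lambda>_. 0) = \<phi> \<and> (\<forall>\<alpha>. continuous_on UNIV (\<Phi> \<alpha>)) \<and>
     (\<forall>\<alpha> i x. ((\<lambda>t::real. \<Phi> \<alpha> (x + t *\<^sub>R axis i 1)) has_vector_derivative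
                   \<Phi> (\<alpha>(i := Suc (\<alpha> i))) x) (at 0))"

definition smooth :: "(real^'n::finite \<Rightarrow> complex) \<Rightarrow> bool" where
  "smooth \<phi> \<longleftrightarrow> (\<exists>\<Phi>. smooth_family \<phi> \<Phi>)"

definition Dmi :: "('n::finite) multi_index \<Rightarrow> (real^'n \<Rightarrow> complex) \<Rightarrow> real^'n \<Rightarrow> complex" where
  "Dmi \<alpha> \<phi> = (THE \<Phi>. smooth_family \<phi> \<Phi>) \<alpha>"

definition supp :: "(real^'n::finite \<Rightarrow> complex) \<Rightarrow> (real^'n) set" where
  "supp \<phi> = closure {x. \<phi> x \<noteq> 0}"

definition DK_bound :: "(nat \<Rightarrow> real) \<Rightarrow> real \<Rightarrow> real \<Rightarrow> (real^'n::finite \<Rightarrow> complex) \<Rightarrow> bool" where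
  "DK_bound M h A \<phi> \<longleftrightarrow>
     (\<forall>\<alpha> x. h ^ mi_len \<alpha> * norm (Dmi \<alpha> \<phi> x) \<le> A * M (mi_len \<alpha>))"

text \<open>beurling = True: type (M_p); beurling = False: type {M_p}.\<close>
definition test_space :: "bool \<Rightarrow> (nat \<Rightarrow> real) \<Rightarrow> (real^'n::finite \<Rightarrow> complex) set" where
  "test_space beurling M = {\<phi>. smooth \<phi> \<and> compact (supp \<phi>) \<and>
     (if beurling then (\<forall>h>0. \<exists>A. DK_bound M h A \<phi>)
      else (\<exists>h>0. \<exists>A. DK_bound M h A \<phi>))}"

definition lin_on :: "('b \<Rightarrow> complex) set \<Rightarrow> (('b \<Rightarrow> complex) \<Rightarrow> complex) \<Rightarrow> bool" where
  "lin_on V S \<longleftrightarrow> (\<forall>\<phi>\<in>V. \<forall>\<psi>\<in>V. \<forall>a b::complex.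
      S (\<lambda>x. a * \<phi> x + b * \<psi> x) = a * S \<phi> + b * S \<psi>)"

definition ultradistribution ::
  "bool \<Rightarrow> (nat \<Rightarrow> real) \<Rightarrow> ((real^'n::finite \<Rightarrow> complex) \<Rightarrow> complex) \<Rightarrow> bool" where
  "ultradistribution beurling M S \<longleftrightarrow>
     lin_on (test_space beurling M) S \<and>
     (\<forall>K. compact K \<longrightarrow>
       (if beurling then
          (\<exists>h>0. \<exists>C. \<forall>\<phi>\<in>test_space beurling M. supp \<phi> \<subseteq> K \<longrightarrow>
              (\<forall>A. DK_bound M h A \<phi> \<longrightarrow> norm (S \<phi>) \<le> C * A))
        else
          (\<forall>h>0. \<exists>C. \<forall>\<phi>\<in>test_space beurling M. supp \<phi> \<subseteq> K \<longrightarrow>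
              (\<forall>A. DK_bound M h A \<phi> \<longrightarrow> norm (S \<phi>) \<le> C * A))))"

definition japan :: "real^'n::finite \<Rightarrow> real" where
  "japan x = sqrt (1 + (norm x)\<^sup>2)"

definition sigma_bound :: "(nat \<Rightarrow> real) \<Rightarrow> real \<Rightarrow> real \<Rightarrow> (real^'n::finite \<Rightarrow> complex) \<Rightarrow> bool" where
  "sigma_bound M m A \<phi> \<longleftrightarrow>
     (\<forall>(\<alpha>::'n multi_index) (\<beta>::'n multi_index) x.
        m ^ (mi_len \<alpha> + mi_len \<beta>) * japan x ^ mi_len \<beta> * norm (Dmi \<alpha> \<phi> x)
          \<le> A * (M (mi_len \<alpha>) * M (mi_len \<beta>)))"

definition S_space :: "bool \<Rightarrow> (nat \<Rightarrow> real) \<Rightarrow> (real^'n::finite \<Rightarrow> complex) set" where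
  "S_space beurling M = {\<phi>. smooth \<phi> \<and>
     (if beurling then (\<forall>m>0. \<exists>A. sigma_bound M m A \<phi>)
      else (\<exists>m>0. \<exists>A. sigma_bound M m A \<phi>))}"

definition tempered_ultradistribution ::
  "bool \<Rightarrow> (nat \<Rightarrow> real) \<Rightarrow> ((real^'n::finite \<Rightarrow> complex) \<Rightarrow> complex) \<Rightarrow> bool" where
  "tempered_ultradistribution beurling M T \<longleftrightarrow>
     lin_on (S_space beurling M) T \<and>
     (if beurling then
        (\<exists>m>0. \<exists>C. \<forall>\<phi>\<in>S_space beurling M. \<forall>A. sigma_bound M m A \<phi> \<longrightarrow> norm (T \<phi>) \<le> C * A)
      else
        (\<forall>m>0. \<exists>C. \<forall>\<phi>\<in>S_space beurling M. \<forall>A. sigma_bound M m A \<phi> \<longrightarrow> norm (T \<phi>) \<le> C * A))"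

definition fourier :: "(real^'n::finite \<Rightarrow> complex) \<Rightarrow> real^'n \<Rightarrow> complex" where
  "fourier \<phi> \<eta> = integral\<^sup>L lborel (\<lambda>x. exp (- (\<i> * complex_of_real (x \<bullet> \<eta>))) * \<phi> x)"

definition tube_pt :: "real^'n \<Rightarrow> real^'n \<Rightarrow> complex^'n" where
  "tube_pt \<xi> \<eta> = (\<chi> j. Complex (\<xi> $ j) (\<eta> $ j))"

text \<open>Holomorphic (= analytic) functions of several complex variables:
  complex-Frechet-differentiable at each point of U.\<close>
definition holomorphic_on_n :: "(complex^'n::finite \<Rightarrow> complex) \<Rightarrow> (complex^'n) set \<Rightarrow> bool" where
  "holomorphic_on_n f U \<longleftrightarrow> open U \<and>
     (\<forall>z\<in>U. \<exists>L. (f has_derivative L) (at z) \<and> (\<forall>c v. L (c *s v) = c * L v))"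

end

theory Submission
  imports Defs "HOL-Probability.Probability" "HOL-Complex_Analysis.Complex_Analysis"
begin

text \<open>
  For a test function \<open>\<phi>\<close> let \<open>L \<phi> \<zeta> = \<integral> e^(x\<zeta>) \<phi>(x) dx\<close>.  With \<open>\<xi>0 \<in> B\<close> fixed, put
  \<open>S \<phi> = (2\<pi>)^(-d) \<integral> f(\<xi>0 + i\<eta>) L \<phi> (\<xi>0 + i\<eta>) d\<eta>\<close> and
  \<open>T \<phi> = (2\<pi>)^(-d) \<integral> f(\<xi> + i\<eta>) L \<phi> (i\<eta>) d\<eta>\<close>.  Integration by parts bounds \<open>|\<eta>|^p |L \<phi>|\<close> by
  \<open>M_p / h^p\<close>, and (M.2) turns this into decay that beats the growth \<open>exp (M(k|\<eta>|))\<close> of \<open>f\<close> with an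
  integrable factor to spare; this gives both continuity estimates.  Fourier inversion identifies \<open>T\<close> on
  Fourier transforms.  That \<open>T \<phi>\<close> is \<open>S\<close> applied to \<open>e^(-x\<xi>) \<phi>\<close> says that
  \<open>\<integral> f(\<xi>' + i\<eta>) L \<phi> (\<xi>' - \<xi> + i\<eta>) d\<eta>\<close> does not depend on \<open>\<xi>' \<in> B\<close>.  Locally this is a contour
  shift: Cauchy's theorem on the unit square of the complex line through \<open>\<xi> + i\<eta>\<close> in direction \<open>e\<close>, integrated
  over \<open>\<eta>\<close>, has two sides that cancel by translation invariance, so no decay of derivatives is needed.
  Connectedness of \<open>B\<close> does the rest.
\<close>

section \<open>Gaussians and Fourier inversion\<close>

text \<open>The formulas for \<open>S\<close> and \<open>T\<close> are forced. If
  \<open>e^(-x\<xi>) S\<close> has the transform f(\<xi> + i\<eta>), it pairs with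
  \<open>\<phi>\<close> as an inverse transform does, and moving that inverse transform onto
  \<open>\<phi>\<close> gives \<open>T\<close>; this fixes the positive sign in e^(x\<zeta>).
  Undoing the factor e^(-x\<xi>0) moves the argument i\<eta> of \<open>L \<phi>\<close> to \<xi>0 +
  i\<eta> and gives \<open>S\<close>. A function in \<open>S_space\<close> need not tolerate an
  exponential weight, so \<open>T\<close> keeps \<open>L \<phi>\<close> on the imaginary axis;
  compact support allows every real part. The two types differ in the order of quantifiers between
  the growth parameter k of \<open>f\<close> and the smoothness parameter h of
  \<open>\<phi>\<close>. To have one estimate for both, the decay lemmas fix H from (M.2), then C
  depending on h, and then admit every k with k d H \<le> h. The dimension d is lost in passing from
  |\<eta>| to its largest coordinate; H is lost when 2d powers of |\<eta>| are spent on
  integrability. Constants are linear in A because continuity is expressed through every admissible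
  bound A instead of a norm.\<close>

lemma lborel_integral_prod:
  fixes f :: "'a::euclidean_space \<Rightarrow> real \<Rightarrow> 'b::{real_normed_field,banach,second_countable_topology}"
  assumes "\<And>b. b \<in> Basis \<Longrightarrow> integrable lborel (f b)"
  shows "integrable lborel (\<lambda>x::'a. \<Prod>b\<in>Basis. f b (x \<bullet> b))"
    and "integral\<^sup>L lborel (\<lambda>x::'a. \<Prod>b\<in>Basis. f b (x \<bullet> b)) = (\<Prod>b\<in>Basis. integral\<^sup>L lborel (f b))"
proof -
  interpret product_sigma_finite "\<lambda>_::'a. lborel :: real measure" ..
  have [measurable]: "f b \<in> borel_measurable borel" if "b \<in> Basis" for b
    using assms[OF that] by (simp add: borel_measurable_integrable flip: measurable_lborel2)
  have m: "(\<lambda>x::'a. \<Prod>b\<in>Basis. f b (x \<bullet> b)) \<in> borel_measurable borel"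
    by measurable
  have T: "(\<lambda>g. \<Sum>b\<in>Basis. g b *\<^sub>R b) \<in> measurable (\<Pi>\<^sub>M b\<in>(Basis::'a set). (lborel::real measure)) (borel :: 'a measure)"
    by measurable
  have eq: "(\<Prod>b\<in>Basis. f b ((\<Sum>c\<in>Basis. g c *\<^sub>R c) \<bullet> b)) = (\<Prod>b\<in>Basis. f b (g b))" for g
    by (intro prod.cong) auto
  show "integrable lborel (\<lambda>x::'a. \<Prod>b\<in>Basis. f b (x \<bullet> b))"
    by (subst lborel_eq, subst integrable_distr_eq[OF T m])
       (simp only: eq, intro product_integrable_prod assms, auto)
  show "integral\<^sup>L lborel (\<lambda>x::'a. \<Prod>b\<in>Basis. f b (x \<bullet> b)) = (\<Prod>b\<in>Basis. integral\<^sup>L lborel (f b))"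
    by (subst lborel_eq, subst integral_distr[OF T m])
       (simp only: eq, intro product_integral_prod assms, auto)
qed

text \<open>One factor per coordinate reduces integrability to dimension one. This is the common
  majorant of the integrals over \<eta> and of the functions in \<open>S_space\<close>.\<close>

definition wt :: "'a::euclidean_space \<Rightarrow> real" where
  "wt x = (\<Prod>b\<in>Basis. 1 / (1 + (x \<bullet> b)\<^sup>2))"

lemma wt_pos: "wt x > 0"
  unfolding wt_def by (intro prod_pos) (auto intro: add_pos_nonneg)

lemma integrable_wt: "integrable lborel (wt :: 'a::euclidean_space \<Rightarrow> real)"
proof -
  have "integrable lborel (\<lambda>x::real. 1 / (1 + x\<^sup>2))"
    using integrable_inverse_1_plus_square
    by (simp add: set_integrable_def divide_inverse)
  then show ?thesis
    unfolding wt_def[abs_def] by (intro lborel_integral_prod) auto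
qed

text \<open>Serves two purposes: rescaling in the Gaussian regularisation and, with
  \<open>c = 1\<close>, translation invariance in the contour shift.\<close>

lemma lborel_integral_affine:
  fixes f :: "'a::euclidean_space \<Rightarrow> 'b::{banach,second_countable_topology}" and t :: 'a
  assumes "c > 0" "integrable lborel f"
  shows "integrable lborel (\<lambda>x. f (t + c *\<^sub>R x))"
    and "integral\<^sup>L lborel f = c ^ DIM('a) *\<^sub>R integral\<^sup>L lborel (\<lambda>x. f (t + c *\<^sub>R x))"
proof -
  have [measurable]: "f \<in> borel_measurable borel"
    using borel_measurable_integrable[OF assms(2)] by simp
  have e: "(lborel :: 'a measure) = density (distr lborel borel (\<lambda>x. t + c *\<^sub>R x)) (\<lambda>_. ennreal (c ^ DIM('a)))"
    using lborel_affine[of c t] assms(1) by simp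
  have "integrable (density (distr lborel borel (\<lambda>x. t + c *\<^sub>R x)) (\<lambda>_. ennreal (c ^ DIM('a)))) f"
    using assms(2) e by metis
  then have "integrable (distr lborel borel (\<lambda>x. t + c *\<^sub>R x)) (\<lambda>x. c ^ DIM('a) *\<^sub>R f x)"
    by (subst (asm) integrable_density) (use assms(1) in auto)
  then have "integrable (distr lborel borel (\<lambda>x. t + c *\<^sub>R x)) (\<lambda>x. (1 / c ^ DIM('a)) *\<^sub>R (c ^ DIM('a) *\<^sub>R f x))"
    by (rule integrable_scaleR_right)
  then have "integrable (distr lborel borel (\<lambda>x. t + c *\<^sub>R x)) f"
    using assms(1) by simp
  then show "integrable lborel (\<lambda>x. f (t + c *\<^sub>R x))"
    by (subst (asm) integrable_distr_eq) auto
  have "integral\<^sup>L lborel f = integral\<^sup>L (density (distr lborel borel (\<lambda>x. t + c *\<^sub>R x)) (\<lambda>_. ennreal (c ^ DIM('a)))) f"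
    using e by metis
  also have "\<dots> = integral\<^sup>L (distr lborel borel (\<lambda>x. t + c *\<^sub>R x)) (\<lambda>x. c ^ DIM('a) *\<^sub>R f x)"
    by (subst integral_density) (use assms(1) in auto)
  also have "\<dots> = c ^ DIM('a) *\<^sub>R integral\<^sup>L lborel (\<lambda>x. f (t + c *\<^sub>R x))"
    by (subst integral_distr) auto
  finally show "integral\<^sup>L lborel f = c ^ DIM('a) *\<^sub>R integral\<^sup>L lborel (\<lambda>x. f (t + c *\<^sub>R x))" .
qed

definition gauss :: "'a::euclidean_space \<Rightarrow> real" where
  "gauss x = exp (- (norm x)\<^sup>2 / 2)"

lemma gauss_pos: "gauss x > 0" and gauss_le_1: "gauss x \<le> 1" and gauss_minus: "gauss (- x) = gauss x"
  by (auto simp: gauss_def)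

lemma continuous_gauss: "continuous_on A gauss"
  unfolding gauss_def[abs_def] by (intro continuous_intros) auto

lemma measurable_gauss [measurable]: "gauss \<in> borel_measurable borel"
  by (rule borel_measurable_continuous_onI[OF continuous_gauss])

text \<open>Up to the factor sqrt (2 pi) this is the characteristic function of the standard normal
  distribution.\<close>

lemma gauss_fourier_1:
  fixes v :: real
  shows "integrable lborel (\<lambda>x. exp (\<i> * of_real (x * v)) * of_real (exp (- x\<^sup>2 / 2)))"
    and "integral\<^sup>L lborel (\<lambda>x. exp (\<i> * of_real (x * v)) * of_real (exp (- x\<^sup>2 / 2)))
           = of_real (sqrt (2 * pi) * exp (- v\<^sup>2 / 2))"
proof -
  have e: "exp (- x\<^sup>2 / 2) = sqrt (2*pi) * std_normal_density x" for x
    by (simp add: std_normal_density_def)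
  have i: "integrable lborel std_normal_density"
    by (rule integrable_normal_density) simp
  have i': "integrable lborel (\<lambda>x. std_normal_density x *\<^sub>R exp (\<i> * of_real (x * v)))"
    by (rule Bochner_Integration.integrable_bound[OF i]) (auto simp: norm_exp_i_times)
  have e': "exp (\<i> * of_real (x * v)) * of_real (exp (- x\<^sup>2 / 2)) = 
      of_real (sqrt (2*pi)) * (std_normal_density x *\<^sub>R exp (\<i> * of_real (x * v)))" for x
    unfolding e by (simp add: scaleR_conv_of_real)
  show "integrable lborel (\<lambda>x. exp (\<i> * of_real (x * v)) * of_real (exp (- x\<^sup>2 / 2)))"
    unfolding e' by (intro integrable_mult_right i')
  have "integral\<^sup>L lborel (\<lambda>x. std_normal_density x *\<^sub>R exp (\<i> * of_real (x * v))) = char std_normal_distribution v"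
    unfolding char_def by (subst integral_density) (auto simp: mult_ac normal_density_nonneg)
  then show "integral\<^sup>L lborel (\<lambda>x. exp (\<i> * of_real (x * v)) * of_real (exp (- x\<^sup>2 / 2)))
           = of_real (sqrt (2 * pi) * exp (- v\<^sup>2 / 2))"
    unfolding e' by (subst integral_mult_right_zero) (simp add: char_std_normal_distribution exp_of_real)
qed

lemma gauss_fourier:
  fixes v :: "'a::euclidean_space"
  shows "integrable lborel (\<lambda>x::'a. exp (\<i> * of_real (x \<bullet> v)) * of_real (gauss x))"
    and "integral\<^sup>L lborel (\<lambda>x::'a. exp (\<i> * of_real (x \<bullet> v)) * of_real (gauss x))
           = of_real (sqrt (2 * pi) ^ DIM('a) * gauss v)"
proof -
  have g: "gauss (x::'a) = (\<Prod>b\<in>Basis. exp (- (x \<bullet> b)\<^sup>2 / 2))" for x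
    unfolding gauss_def power2_norm_eq_inner euclidean_inner[of x x]
    by (simp add: exp_sum[symmetric] sum_divide_distrib sum_negf power2_eq_square)
  have e: "exp (\<i> * of_real (x \<bullet> v)) * of_real (gauss x) =
     (\<Prod>b\<in>Basis. exp (\<i> * of_real ((x \<bullet> b) * (v \<bullet> b))) * of_real (exp (- (x \<bullet> b)\<^sup>2 / 2)))" for x :: 'a
    unfolding g prod.distrib of_real_prod
    by (simp add: euclidean_inner[of x v] exp_sum[symmetric] sum_distrib_left)
  show "integrable lborel (\<lambda>x::'a. exp (\<i> * of_real (x \<bullet> v)) * of_real (gauss x))"
    unfolding e by (rule lborel_integral_prod(1)) (rule gauss_fourier_1)
  show "integral\<^sup>L lborel (\<lambda>x::'a. exp (\<i> * of_real (x \<bullet> v)) * of_real (gauss x))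
           = of_real (sqrt (2 * pi) ^ DIM('a) * gauss v)"
    unfolding e g[of v]
    by (subst lborel_integral_prod(2)[OF gauss_fourier_1(1)])
       (simp only: gauss_fourier_1(2), simp add: prod.distrib)
qed

text \<open>Continuity of \<open>\<psi>\<close> gives the identity at every point y instead of
  almost every one, and boundedness supplies the dominating function in the limit on the side of
  \<open>\<psi>\<close>.\<close>

theorem fourier_inversion:
  fixes \<psi> :: "'a::euclidean_space \<Rightarrow> complex"
  defines "F \<equiv> \<lambda>x. integral\<^sup>L lborel (\<lambda>\<eta>. exp (- (\<i> * of_real (\<eta> \<bullet> x))) * \<psi> \<eta>)"
  assumes i: "integrable lborel \<psi>" and c: "continuous_on UNIV \<psi>" and bd: "\<And>x. norm (\<psi> x) \<le> C"
    and iF: "integrable lborel F"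
  shows "integral\<^sup>L lborel (\<lambda>x. exp (\<i> * of_real (x \<bullet> y)) * F x) = of_real ((2 * pi) ^ DIM('a)) * \<psi> y"
proof -
  define e where "e k = inverse (real (Suc k))" for k
  have e_pos: "e k > 0" for k by (simp add: e_def)
  have e_lim: "e \<longlonglongrightarrow> 0" unfolding e_def[abs_def] by (rule LIMSEQ_inverse_real_of_nat)
  have m\<psi> [measurable]: "\<psi> \<in> borel_measurable borel" by (rule borel_measurable_continuous_onI[OF c])
  have mF [measurable]: "F \<in> borel_measurable borel" using borel_measurable_integrable[OF iF] by simp
  have gi: "integrable lborel (gauss :: 'a \<Rightarrow> real)"
    using gauss_fourier(1)[of "0::'a"] by (simp add: complex_of_real_integrable_eq)
  have gint: "integral\<^sup>L lborel (\<lambda>x::'a. complex_of_real (gauss x)) = of_real (sqrt (2 * pi) ^ DIM('a))"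
    using gauss_fourier(2)[of "0::'a"] by (simp add: gauss_def)
  \<comment> \<open>Gaussian regularisation: evaluate \<open>J k\<close> with the Gaussian on the side of \<open>F\<close> and, by Fubini, on the side of \<open>\<psi>\<close>.\<close>
  define J where "J k = integral\<^sup>L lborel (\<lambda>x. exp (\<i> * of_real (x \<bullet> y)) * of_real (gauss (e k *\<^sub>R x)) * F x)" for k
  have J1: "J \<longlonglongrightarrow> integral\<^sup>L lborel (\<lambda>x. exp (\<i> * of_real (x \<bullet> y)) * F x)"
    unfolding J_def
  proof (rule integral_dominated_convergence[where w="\<lambda>x. norm (F x)"])
    show "AE x in lborel. (\<lambda>k. exp (\<i> * of_real (x \<bullet> y)) * of_real (gauss (e k *\<^sub>R x)) * F x) 
             \<longlonglongrightarrow> exp (\<i> * of_real (x \<bullet> y)) * F x"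
    proof (rule AE_I2)
      fix x :: 'a
      have "(\<lambda>k. gauss (e k *\<^sub>R x)) \<longlonglongrightarrow> gauss ((0::real) *\<^sub>R x)"
        unfolding gauss_def by (intro tendsto_intros e_lim) auto
      then have "(\<lambda>k. exp (\<i> * of_real (x \<bullet> y)) * of_real (gauss (e k *\<^sub>R x)) * F x) 
          \<longlonglongrightarrow> exp (\<i> * of_real (x \<bullet> y)) * of_real (gauss ((0::real) *\<^sub>R x)) * F x"
        by (intro tendsto_intros)
      then show "(\<lambda>k. exp (\<i> * of_real (x \<bullet> y)) * of_real (gauss (e k *\<^sub>R x)) * F x) 
             \<longlonglongrightarrow> exp (\<i> * of_real (x \<bullet> y)) * F x" by (simp add: gauss_def)
    qed
    show "AE x in lborel. norm (exp (\<i> * of_real (x \<bullet> y)) * of_real (gauss (e k *\<^sub>R x)) * F x) \<le> norm (F x)" for k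
      by (rule AE_I2) (simp add: norm_mult norm_exp_i_times mult_left_le_one_le gauss_le_1 less_imp_le[OF gauss_pos])
  qed (use iF in auto)
  have inner: "integral\<^sup>L lborel (\<lambda>x. exp (\<i> * of_real (x \<bullet> v)) * of_real (gauss (e k *\<^sub>R x)))
     = of_real (sqrt (2*pi) ^ DIM('a) * gauss (v /\<^sub>R e k) / e k ^ DIM('a))" (is "?I = _")
    and inner_i: "integrable lborel (\<lambda>x. exp (\<i> * of_real (x \<bullet> v)) * of_real (gauss (e k *\<^sub>R x)))" for v :: 'a and k
  proof -
    note A = lborel_integral_affine[OF e_pos[of k] gauss_fourier(1)[of "v /\<^sub>R e k"], of 0]
    have eq: "(0 + e k *\<^sub>R x) \<bullet> (v /\<^sub>R e k) = x \<bullet> v" for x :: 'a using e_pos[of k] by simp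
    show "integrable lborel (\<lambda>x. exp (\<i> * of_real (x \<bullet> v)) * of_real (gauss (e k *\<^sub>R x)))"
      using A(1) unfolding eq by simp
    have "of_real (sqrt (2*pi) ^ DIM('a) * gauss (v /\<^sub>R e k)) = of_real (e k ^ DIM('a)) * ?I"
      using A(2) unfolding eq gauss_fourier(2) by (simp add: scaleR_conv_of_real)
    then show "?I = of_real (sqrt (2*pi) ^ DIM('a) * gauss (v /\<^sub>R e k) / e k ^ DIM('a))"
      using e_pos[of k] by (simp add: field_simps)
  qed
  have gei: "integrable lborel (\<lambda>x::'a. gauss (e k *\<^sub>R x))" for k
    using lborel_integral_affine(1)[OF e_pos[of k] gi, of 0] by simp
  \<comment> \<open>After the exchange of integrals, \<open>\<psi>\<close> is integrated against a
    Gaussian of width \<open>e k\<close> centred at y. The substitution \<eta> = y +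
    \<open>e k\<close> u cancels the normalising power of \<open>e k\<close>.\<close>
  have J2: "J k = of_real (sqrt (2*pi) ^ DIM('a)) * integral\<^sup>L lborel (\<lambda>u. of_real (gauss u) * \<psi> (y + e k *\<^sub>R u))" for k
  proof -
    define G where "G x \<eta> = exp (\<i> * of_real (x \<bullet> (y - \<eta>))) * of_real (gauss (e k *\<^sub>R x)) * \<psi> \<eta>" for x \<eta> :: 'a
    have Gm [measurable]: "case_prod G \<in> borel_measurable (lborel \<Otimes>\<^sub>M lborel)"
      unfolding G_def[abs_def] case_prod_beta by measurable
    have nG: "norm (G x \<eta>) = gauss (e k *\<^sub>R x) * norm (\<psi> \<eta>)" for x \<eta>
      using less_imp_le[OF gauss_pos[of "e k *\<^sub>R x"]] by (simp add: G_def norm_mult norm_exp_i_times)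
    have "integrable (lborel \<Otimes>\<^sub>M lborel) (case_prod G)"
    proof (rule lborel_pair.Fubini_integrable[OF Gm])
      show "integrable lborel (\<lambda>x. LBINT y. norm (case_prod G (x, y)))"
        using gei[of k] by (simp add: nG)
      show "AE x in lborel. integrable lborel (\<lambda>y. case_prod G (x, y))"
      proof (rule AE_I2)
        fix x :: 'a
        have "integrable lborel (\<lambda>\<eta>. gauss (e k *\<^sub>R x) * norm (\<psi> \<eta>))" using i by simp
        then show "integrable lborel (\<lambda>y. case_prod G (x, y))"
        proof (rule Bochner_Integration.integrable_bound)
          show "(\<lambda>y. case_prod G (x, y)) \<in> borel_measurable lborel" unfolding G_def by simp
        qed (simp add: nG abs_mult less_imp_le[OF gauss_pos])
      qed
    qed
    then have sw: "integral\<^sup>L lborel (\<lambda>x. integral\<^sup>L lborel (G x)) = integral\<^sup>L lborel (\<lambda>\<eta>. integral\<^sup>L lborel (\<lambda>x. G x \<eta>))"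
      by (rule lborel_pair.Fubini_integral[symmetric])
    have "J k = integral\<^sup>L lborel (\<lambda>x. integral\<^sup>L lborel (G x))"
      unfolding J_def F_def G_def
    proof (intro Bochner_Integration.integral_cong refl, subst integral_mult_right_zero[symmetric], 
          intro Bochner_Integration.integral_cong refl)
      fix x \<eta> :: 'a
      show "exp (\<i> * of_real (x \<bullet> y)) * of_real (gauss (e k *\<^sub>R x)) * (exp (- (\<i> * of_real (\<eta> \<bullet> x))) * \<psi> \<eta>)
        = exp (\<i> * of_real (x \<bullet> (y - \<eta>))) * of_real (gauss (e k *\<^sub>R x)) * \<psi> \<eta>"
        by (simp add: inner_diff_right inner_commute[of x \<eta>] exp_diff exp_minus field_simps)
    qed
    also have "\<dots> = integral\<^sup>L lborel (\<lambda>\<eta>. of_real (sqrt (2*pi) ^ DIM('a) / e k ^ DIM('a)) * (of_real (gauss ((y - \<eta>) /\<^sub>R e k)) * \<psi> \<eta>))"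
      unfolding sw unfolding G_def
      by (intro Bochner_Integration.integral_cong refl, subst integral_mult_left_zero) (simp add: inner)
    also have "\<dots> = of_real (sqrt (2*pi) ^ DIM('a) / e k ^ DIM('a)) * integral\<^sup>L lborel (\<lambda>\<eta>. of_real (gauss ((y - \<eta>) /\<^sub>R e k)) * \<psi> \<eta>)"
      by (rule integral_mult_right_zero)
    also have "integral\<^sup>L lborel (\<lambda>\<eta>. of_real (gauss ((y - \<eta>) /\<^sub>R e k)) * \<psi> \<eta>)
       = e k ^ DIM('a) *\<^sub>R integral\<^sup>L lborel (\<lambda>u. of_real (gauss ((y - (y + e k *\<^sub>R u)) /\<^sub>R e k)) * \<psi> (y + e k *\<^sub>R u))"
    proof (rule lborel_integral_affine(2)[OF e_pos])
      show "integrable lborel (\<lambda>\<eta>. of_real (gauss ((y - \<eta>) /\<^sub>R e k)) * \<psi> \<eta>)"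
        by (rule Bochner_Integration.integrable_bound[OF i])
          (auto simp: norm_mult less_imp_le[OF gauss_pos] gauss_le_1 intro!: mult_left_le_one_le)
    qed
    also have "(\<lambda>u. of_real (gauss ((y - (y + e k *\<^sub>R u)) /\<^sub>R e k)) * \<psi> (y + e k *\<^sub>R u)) = (\<lambda>u. of_real (gauss u) * \<psi> (y + e k *\<^sub>R u))"
      using e_pos[of k] by (simp add: gauss_minus)
    finally show ?thesis using e_pos[of k] by (simp add: scaleR_conv_of_real)
  qed
  have "(\<lambda>k. integral\<^sup>L lborel (\<lambda>u. of_real (gauss u) * \<psi> (y + e k *\<^sub>R u))) 
       \<longlonglongrightarrow> integral\<^sup>L lborel (\<lambda>u::'a. of_real (gauss u) * \<psi> y)"
  proof (rule integral_dominated_convergence[where w="\<lambda>u::'a. gauss u * C"])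
    show "AE u in lborel. (\<lambda>k. of_real (gauss u) * \<psi> (y + e k *\<^sub>R u)) \<longlonglongrightarrow> of_real (gauss u) * \<psi> y"
    proof (rule AE_I2)
      fix u :: 'a
      have l: "(\<lambda>k. y + e k *\<^sub>R u) \<longlonglongrightarrow> y + (0::real) *\<^sub>R u" by (intro tendsto_intros e_lim)
      have "(\<lambda>k. \<psi> (y + e k *\<^sub>R u)) \<longlonglongrightarrow> \<psi> (y + (0::real) *\<^sub>R u)"
        by (rule continuous_on_tendsto_compose[OF c l]) auto
      then show "(\<lambda>k. of_real (gauss u) * \<psi> (y + e k *\<^sub>R u)) \<longlonglongrightarrow> of_real (gauss u) * \<psi> y"
        by (intro tendsto_intros) simp
    qed
  qed (use gi in \<open>simp_all add: norm_mult less_imp_le[OF gauss_pos] mult_left_mono bd\<close>)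
  then have "J \<longlonglongrightarrow> of_real (sqrt (2*pi) ^ DIM('a)) * integral\<^sup>L lborel (\<lambda>u::'a. of_real (gauss u) * \<psi> y)"
    unfolding J2[abs_def] by (intro tendsto_intros)
  \<comment> \<open>One factor \<open>sqrt (2*pi) ^ DIM('a)\<close> comes from the transform of the
    Gaussian, the other from its total mass.\<close>
  from LIMSEQ_unique[OF J1 this]
  have "integral\<^sup>L lborel (\<lambda>x. exp (\<i> * of_real (x \<bullet> y)) * F x)
      = of_real (sqrt (2*pi) ^ DIM('a) * sqrt (2*pi) ^ DIM('a)) * \<psi> y"
    unfolding integral_mult_left_zero gint by simp
  also have "sqrt (2*pi) ^ DIM('a) * sqrt (2*pi) ^ DIM('a) = (2*pi) ^ DIM('a)"
    by (subst power_mult_distrib[symmetric]) (subst real_sqrt_mult_self, simp)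
  finally show ?thesis .
qed

section \<open>Translation, integration by parts and contour shift\<close>

text \<open>Averaging over a unit parameter interval commutes with integration over space. If all
  slices have the same integral, so does their average; this form serves both integration by parts
  and the contour shift.\<close>

lemma integral_slab:
  fixes H :: "real \<Rightarrow> 'a::euclidean_space \<Rightarrow> complex"
  assumes cont: "continuous_on ({0..1} \<times> UNIV) (\<lambda>(t,x). H t x)"
    and int: "\<And>t. t \<in> {0..1} \<Longrightarrow> integrable lborel (H t)"
    and bd: "\<And>t. t \<in> {0..1} \<Longrightarrow> (\<integral>x. norm (H t x) \<partial>lborel) \<le> C"
  shows "integrable lborel (\<lambda>x. integral {0..1} (\<lambda>t. H t x))"
    and "(\<And>t. t \<in> {0..1} \<Longrightarrow> integral\<^sup>L lborel (H t) = c) \<Longrightarrow> (\<integral>x. integral {0..1} (\<lambda>t. H t x) \<partial>lborel) = c"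
proof -
  \<comment> \<open>Extension by zero keeps \<open>G\<close> Borel measurable on the whole product,
    although \<open>H\<close> is continuous only on the slab.\<close>
  define G where "G = (\<lambda>(t,x). indicat_real {0..1} t *\<^sub>R H t x)"
  have eqG: "G = (\<lambda>p. indicat_real ({0..1} \<times> UNIV) p *\<^sub>R (\<lambda>(t,x). H t x) p)"
    by (auto simp: G_def fun_eq_iff indicator_def)
  have "({0..1} \<times> UNIV :: (real \<times> 'a) set) \<in> sets borel"
    by (intro borel_closed closed_Times) auto
  then have Gm0: "G \<in> borel_measurable borel"
    unfolding eqG by (rule borel_measurable_continuous_on_indicator[OF _ cont])
  have Gm [measurable]: "G \<in> borel_measurable (lborel \<Otimes>\<^sub>M lborel)"
    using Gm0 by (simp add: lborel_prod)
  have H_meas: "integrable lborel (\<lambda>x. G (t, x))" for t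
    using int[of t] by (cases "t \<in> {0..1}") (auto simp: G_def)
  have Gi: "integrable (lborel \<Otimes>\<^sub>M lborel) G"
  proof (rule lborel_pair.Fubini_integrable[OF Gm])
    show "AE t in lborel. integrable lborel (\<lambda>x. G (t, x))" using H_meas by auto
    have "integrable lborel (\<lambda>t::real. indicat_real {0..1} t *\<^sub>R C)"
      by (intro integrable_scaleR_left integrable_real_indicator) auto
    then show "integrable lborel (\<lambda>t. \<integral>x. norm (G (t, x)) \<partial>lborel)"
    proof (rule Bochner_Integration.integrable_bound)
      show "AE t in lborel. norm (\<integral>x. norm (G (t, x)) \<partial>lborel) \<le> norm (indicat_real {0..1} t *\<^sub>R C)"
      proof (rule AE_I2)
        fix t :: real
        show "norm (\<integral>x. norm (G (t, x)) \<partial>lborel) \<le> norm (indicat_real {0..1} t *\<^sub>R C)"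
          using bd[of t] by (cases "t \<in> {0..1}") (auto simp: G_def)
      qed
    qed measurable
  qed
  have inner: "(\<integral>t. G (t, x) \<partial>lborel) = integral {0..1} (\<lambda>t. H t x)" for x
  proof -
    have "continuous_on {0..1} (\<lambda>t. (\<lambda>(t,x). H t x) (t, x))"
      by (rule continuous_on_compose2[OF cont]) (auto intro!: continuous_intros)
    then have "set_integrable lborel {0..1} (\<lambda>t. H t x)"
      by (simp add: borel_integrable_atLeastAtMost')
    from set_borel_integral_eq_integral(2)[OF this] show ?thesis
      by (simp add: G_def set_lebesgue_integral_def)
  qed
  show "integrable lborel (\<lambda>x. integral {0..1} (\<lambda>t. H t x))"
    using lborel_pair.integrable_snd[of "\<lambda>t x. G (t, x)"] Gi by (simp add: inner)
  assume c: "\<And>t. t \<in> {0..1} \<Longrightarrow> integral\<^sup>L lborel (H t) = c"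
  have "(\<integral>x. integral {0..1} (\<lambda>t. H t x) \<partial>lborel) = (\<integral>x. \<integral>t. G (t, x) \<partial>lborel \<partial>lborel)"
    by (simp add: inner)
  also have "\<dots> = (\<integral>t. \<integral>x. G (t, x) \<partial>lborel \<partial>lborel)"
    using lborel_pair.Fubini_integral[of "\<lambda>t x. G (t, x)"] Gi by simp
  also have "\<dots> = (\<integral>t. indicat_real {0..1} t *\<^sub>R c \<partial>(lborel::real measure))"
  proof (intro Bochner_Integration.integral_cong refl)
    fix t :: real
    show "(\<integral>x. G (t, x) \<partial>lborel) = indicat_real {0..1} t *\<^sub>R c"
      using c[of t] by (cases "t \<in> {0..1}") (auto simp: G_def)
  qed
  also have "\<dots> = c" by simp
  finally show "(\<integral>x. integral {0..1} (\<lambda>t. H t x) \<partial>lborel) = c" .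
qed

lemma lborel_integral_translation:
  fixes f :: "'a::euclidean_space \<Rightarrow> 'b::{banach,second_countable_topology}"
  assumes "integrable lborel f"
  shows "integrable lborel (\<lambda>x. f (x + t))" "integral\<^sup>L lborel (\<lambda>x. f (x + t)) = integral\<^sup>L lborel f"
  using lborel_integral_affine[OF zero_less_one assms, of t] by (simp_all add: add.commute)

text \<open>The increment \<open>g (x + e) - g x\<close> is the integral of \<open>g'\<close> over a
  unit step. Integrated over x, the increment vanishes by translation invariance, and the other side
  is an average of translates of \<open>g'\<close>, all with the same integral. Integrability of
  \<open>g\<close> thus replaces vanishing at infinity.\<close>

lemma integral_directional_derivative_eq_0:
  fixes g g' :: "'a::euclidean_space \<Rightarrow> complex"
  assumes d: "\<And>x. ((\<lambda>t. g (x + t *\<^sub>R e)) has_vector_derivative g' x) (at 0)"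
    and c: "continuous_on UNIV g'" and i: "integrable lborel g" and i': "integrable lborel g'"
  shows "integral\<^sup>L lborel g' = 0"
proof -
  have D: "((\<lambda>t. g (x + t *\<^sub>R e)) has_vector_derivative g' (x + t *\<^sub>R e)) (at t)" for x t
  proof -
    have "((\<lambda>s. g ((x + t *\<^sub>R e) + s *\<^sub>R e)) has_vector_derivative g' (x + t *\<^sub>R e)) (at (t - t))"
      using d[of "x + t *\<^sub>R e"] by simp
    moreover have "((\<lambda>s. s - t) has_vector_derivative 1) (at t)"
      by (auto intro!: derivative_eq_intros)
    ultimately
    have "((\<lambda>s. g ((x + t *\<^sub>R e) + s *\<^sub>R e)) \<circ> (\<lambda>s. s - t) has_vector_derivative 1 *\<^sub>R g' (x + t *\<^sub>R e)) (at t)"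
      using vector_diff_chain_at by blast
    moreover have "(\<lambda>s. g ((x + t *\<^sub>R e) + s *\<^sub>R e)) \<circ> (\<lambda>s. s - t) = (\<lambda>s. g (x + s *\<^sub>R e))"
      by (auto simp: algebra_simps)
    ultimately show ?thesis by simp
  qed
  have I: "integral {0..1} (\<lambda>t. g' (x + t *\<^sub>R e)) = g (x + e) - g x" for x
    using fundamental_theorem_of_calculus[of 0 1 "\<lambda>t. g (x + t *\<^sub>R e)" "\<lambda>t. g' (x + t *\<^sub>R e)"]
      has_vector_derivative_at_within[OF D] by (auto intro!: integral_unique)
  have "integral\<^sup>L lborel g' = (\<integral>x. integral {0..1} (\<lambda>t. g' (x + t *\<^sub>R e)) \<partial>lborel)"
  proof (rule integral_slab(2)[symmetric])
    show "continuous_on ({0..1} \<times> UNIV) (\<lambda>(t, x). g' (x + t *\<^sub>R e))"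
      unfolding case_prod_beta
      by (rule continuous_on_compose2[OF c]) (auto intro!: continuous_intros)
    show "(\<integral>x. norm (g' (x + t *\<^sub>R e)) \<partial>lborel) \<le> (\<integral>x. norm (g' x) \<partial>lborel)" for t
      using lborel_integral_translation(2)[OF integrable_norm[OF i'], of "t *\<^sub>R e"] by simp
  qed (use lborel_integral_translation[OF i'] in auto)
  also have "\<dots> = 0"
    unfolding I using lborel_integral_translation[OF i, of e] i
    by (subst Bochner_Integration.integral_diff) auto
  finally show ?thesis .
qed

text \<open>Convexity of \<open>B\<close> passes to the domain of the complex parameter u and yields
  a primitive there. The majorant is asked for only along the real segment, since an imaginary
  displacement is a translation in \<eta>, which leaves integrals of norms unchanged.\<close>

theorem integral_contour_shift:
  fixes G :: "'a::euclidean_space \<Rightarrow> 'a \<Rightarrow> complex"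
  assumes B: "open B" "convex B" "\<xi> \<in> B" "\<xi> + e \<in> B"
    and hol: "\<And>\<eta>. (\<lambda>u. G (\<xi> + Re u *\<^sub>R e) (\<eta> + Im u *\<^sub>R e)) holomorphic_on {u. \<xi> + Re u *\<^sub>R e \<in> B}"
    and cont: "continuous_on (B \<times> UNIV) (\<lambda>(\<xi>,\<eta>). G \<xi> \<eta>)"
    and bd: "\<And>t \<eta>. t \<in> {0..1} \<Longrightarrow> norm (G (\<xi> + t *\<^sub>R e) \<eta>) \<le> F \<eta>"
    and F: "integrable lborel F"
  shows "integral\<^sup>L lborel (G (\<xi> + e)) = integral\<^sup>L lborel (G \<xi>)"
proof -
  have seg: "\<xi> + t *\<^sub>R e \<in> B" if "t \<in> {0..1}" for t
  proof -
    have "(1 - t) *\<^sub>R \<xi> + t *\<^sub>R (\<xi> + e) \<in> B"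
      by (rule convexD_alt) (use B that in auto)
    then show ?thesis by (simp add: algebra_simps)
  qed
  define U where "U = {u::complex. \<xi> + Re u *\<^sub>R e \<in> B}"
  have oU: "open U"
  proof -
    have "U = (\<lambda>u. \<xi> + Re u *\<^sub>R e) -` B" by (auto simp: U_def)
    then show ?thesis using continuous_open_vimage[OF B(1), of "\<lambda>u::complex. \<xi> + Re u *\<^sub>R e"] by (simp add: continuous_intros)
  qed
  have cU: "convex U"
  proof (rule convexI)
    fix x y :: complex and u v :: real
    assume *: "x \<in> U" "y \<in> U" "0 \<le> u" "0 \<le> v" "u + v = 1"
    have "u *\<^sub>R (\<xi> + Re x *\<^sub>R e) + v *\<^sub>R (\<xi> + Re y *\<^sub>R e) \<in> B"
      using * B(2) by (intro convexD) (auto simp: U_def)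
    also have "u *\<^sub>R (\<xi> + Re x *\<^sub>R e) + v *\<^sub>R (\<xi> + Re y *\<^sub>R e) = (u + v) *\<^sub>R \<xi> + Re (u *\<^sub>R x + v *\<^sub>R y) *\<^sub>R e"
      by (simp add: algebra_simps)
    finally show "u *\<^sub>R x + v *\<^sub>R y \<in> U" using * by (simp add: U_def)
  qed
  have Fb: "(\<integral>\<eta>. norm (G (\<xi> + t *\<^sub>R e) (\<eta> + s *\<^sub>R e)) \<partial>lborel) \<le> integral\<^sup>L lborel F"
    and Gi: "integrable lborel (\<lambda>\<eta>. G (\<xi> + t *\<^sub>R e) (\<eta> + s *\<^sub>R e))"
    if t: "t \<in> {0..1}" for t s
  proof -
    have "continuous_on UNIV (\<lambda>\<eta>. (\<lambda>(\<xi>,\<eta>). G \<xi> \<eta>) (\<xi> + t *\<^sub>R e, \<eta>))"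
      by (rule continuous_on_compose2[OF cont]) (use seg[OF t] in \<open>auto intro!: continuous_intros\<close>)
    then have [measurable]: "G (\<xi> + t *\<^sub>R e) \<in> borel_measurable borel"
      by (intro borel_measurable_continuous_onI) simp
    have i: "integrable lborel (G (\<xi> + t *\<^sub>R e))"
      by (rule Bochner_Integration.integrable_bound[OF F]) (use bd[OF t] order_trans[OF _ abs_ge_self] in auto)
    show "integrable lborel (\<lambda>\<eta>. G (\<xi> + t *\<^sub>R e) (\<eta> + s *\<^sub>R e))"
      by (rule lborel_integral_translation[OF i])
    show "(\<integral>\<eta>. norm (G (\<xi> + t *\<^sub>R e) (\<eta> + s *\<^sub>R e)) \<partial>lborel) \<le> integral\<^sup>L lborel F"
      unfolding lborel_integral_translation(2)[OF integrable_norm[OF i]]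
      by (rule integral_mono) (use i F bd[OF t] in auto)
  qed
  \<comment> \<open>\<open>A \<eta>\<close> is the side of the square parallel to the real axis;
    \<open>L t \<eta>\<close> is the side parallel to the imaginary axis at abscissa t, without the
    factor i of the path element.\<close>
  define A where "A \<eta> = integral {0..1} (\<lambda>t. G (\<xi> + t *\<^sub>R e) \<eta>)" for \<eta>
  define L where "L t \<eta> = integral {0..1} (\<lambda>v. G (\<xi> + t *\<^sub>R e) (\<eta> + v *\<^sub>R e))" for t \<eta>
  have Ai: "integrable lborel A"
    unfolding A_def[abs_def]
  proof (rule integral_slab(1))
    show "continuous_on ({0..1} \<times> UNIV) (\<lambda>(t, x). G (\<xi> + t *\<^sub>R e) x)"
    proof -
      have "continuous_on ({0..1} \<times> UNIV) (\<lambda>p. (\<lambda>(\<xi>,\<eta>). G \<xi> \<eta>) (\<xi> + fst p *\<^sub>R e, snd p))"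
        by (rule continuous_on_compose2[OF cont]) (use seg in \<open>auto intro!: continuous_intros\<close>)
      then show ?thesis by (simp add: case_prod_beta)
    qed
  qed (use Fb[of _ 0] Gi[of _ 0] in auto)
  have L: "integrable lborel (L t)" "integral\<^sup>L lborel (L t) = integral\<^sup>L lborel (G (\<xi> + t *\<^sub>R e))"
    if t: "t \<in> {0..1}" for t
  proof -
    have c: "continuous_on ({0..1} \<times> UNIV) (\<lambda>(v, \<eta>). G (\<xi> + t *\<^sub>R e) (\<eta> + v *\<^sub>R e))"
    proof -
      have "continuous_on ({0..1} \<times> UNIV) (\<lambda>p. (\<lambda>(\<xi>,\<eta>). G \<xi> \<eta>) (\<xi> + t *\<^sub>R e, snd p + fst p *\<^sub>R e))"
        by (rule continuous_on_compose2[OF cont]) (use seg[OF t] in \<open>auto intro!: continuous_intros\<close>)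
      then show ?thesis by (simp add: case_prod_beta)
    qed
    show "integrable lborel (L t)"
      unfolding L_def[abs_def] by (rule integral_slab(1)[OF c]) (use Fb[OF t] Gi[OF t] in auto)
    show "integral\<^sup>L lborel (L t) = integral\<^sup>L lborel (G (\<xi> + t *\<^sub>R e))"
      unfolding L_def[abs_def]
      by (rule integral_slab(2)[OF c])
        (use Fb[OF t] Gi[OF t] lborel_integral_translation(2)[of "G (\<xi> + t *\<^sub>R e)"] Gi[OF t, of 0] in auto)
  qed
  \<comment> \<open>Each side of the square is a difference of values of a primitive at two corners,
    so Cauchy's theorem reduces to a sum of corner values that cancels.\<close>
  have rect: "\<i> * L 1 \<eta> - \<i> * L 0 \<eta> = A (\<eta> + e) - A \<eta>" for \<eta>
  proof -
    define g where "g u = G (\<xi> + Re u *\<^sub>R e) (\<eta> + Im u *\<^sub>R e)" for u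
    have "g holomorphic_on U" using hol[of \<eta>] by (simp add: g_def[abs_def] U_def)
    then obtain P where "\<And>u. u \<in> U \<Longrightarrow> (P has_field_derivative g u) (at u within U)"
      by (rule holomorphic_convex_primitive'[OF cU oU]) blast
    then have P: "(P has_field_derivative g u) (at u)" if "u \<in> U" for u
      using at_within_open[OF that oU] that by metis
    have h: "((\<lambda>t. c * g (a + of_real t * c)) has_integral (P (a + c) - P a)) {0..1}" 
      if "\<And>t. t \<in> {0..1} \<Longrightarrow> a + of_real t * c \<in> U" for a c
    proof -
      have "((\<lambda>t. c * g (a + of_real t * c)) has_integral (P (a + of_real 1 * c) - P (a + of_real 0 * c))) {0..1}"
      proof (rule fundamental_theorem_of_calculus)
        fix t :: real assume t: "t \<in> {0..1}"
        have "((\<lambda>t. a + of_real t * c) has_vector_derivative c) (at t within {0..1})"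
          by (auto intro!: derivative_eq_intros)
        from field_vector_diff_chain_within[OF this has_field_derivative_at_within[OF P[OF that[OF t]]]]
        show "((\<lambda>t. P (a + of_real t * c)) has_vector_derivative c * g (a + of_real t * c)) (at t within {0..1})"
          by (simp add: o_def)
      qed simp
      then show ?thesis by simp
    qed
    have e1: "((\<lambda>t. G (\<xi> + t *\<^sub>R e) (\<eta> + s *\<^sub>R e)) has_integral (P (Complex 1 s) - P (Complex 0 s))) {0..1}" for s
      
    proof -
      have "Complex 0 s + 1 = Complex 1 s" by (simp add: complex_eq_iff)
      then show ?thesis using h[of "Complex 0 s" 1] seg by (simp add: g_def U_def)
    qed
    have e2: "((\<lambda>v. \<i> * G (\<xi> + t *\<^sub>R e) (\<eta> + v *\<^sub>R e)) has_integral (P (Complex t 1) - P (Complex t 0))) {0..1}" 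
      if "t \<in> {0..1}" for t
      
    proof -
      have "Complex t 0 + \<i> = Complex t 1" by (simp add: complex_eq_iff)
      then show ?thesis using h[of "Complex t 0" \<i>] seg[OF that] by (simp add: g_def U_def)
    qed
    have "A \<eta> = P (Complex 1 0) - P (Complex 0 0)" "A (\<eta> + e) = P (Complex 1 1) - P (Complex 0 1)"
      unfolding A_def using integral_unique[OF e1[of 0]] integral_unique[OF e1[of 1]] by simp_all
    moreover have "\<i> * L 1 \<eta> = P (Complex 1 1) - P (Complex 1 0)" "\<i> * L 0 \<eta> = P (Complex 0 1) - P (Complex 0 0)"
      unfolding L_def using integral_unique[OF e2[of 1]] integral_unique[OF e2[of 0]] by simp_all
    ultimately show ?thesis by simp
  qed
  have "\<i> * integral\<^sup>L lborel (L 1) - \<i> * integral\<^sup>L lborel (L 0) = (\<integral>\<eta>. \<i> * L 1 \<eta> - \<i> * L 0 \<eta> \<partial>lborel)"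
    using L(1)[of 1] L(1)[of 0] by simp
  also have "\<dots> = 0"
    unfolding rect using lborel_integral_translation[OF Ai, of e] Ai by simp
  finally show ?thesis using L(2)[of 1] L(2)[of 0] by simp
qed

section \<open>Decay against the associated function\<close>

text \<open>The bound on the terms also bounds the set under the supremum, so the junk value of an unbounded \<open>Sup\<close>
  does not arise; the case \<open>\<rho> = 0\<close> relies on \<open>ln 0 = 0\<close>.\<close>
lemma exp_assoc_fun_le:
  assumes M: "M 0 = 1" "\<And>p. M p > 0" and "\<rho> \<ge> 0" "a \<ge> 0" and le: "\<And>p. \<rho> ^ p * a \<le> c * M p"
  shows "exp (assoc_fun M \<rho>) * a \<le> c"
proof (cases "a = 0")
  case True
  then show ?thesis using le[of 0] M(1) by simp
next
  case False
  with assms have a: "a > 0" by simp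
  have ac: "a \<le> c" using le[of 0] M(1) by simp
  have "assoc_fun M \<rho> \<le> ln (c / a)"
    unfolding assoc_fun_def
  proof (rule cSUP_least)
    fix p
    have "ln (\<rho> ^ p / M p) \<le> ln (c / a)"
    proof (cases "\<rho> ^ p = 0")
      case True
      then show ?thesis using a ac by (simp del: power_eq_0_iff)
    next
      case False
      then have "0 < \<rho> ^ p" using zero_le_power[OF assms(3), of p] by linarith
      then have "0 < \<rho> ^ p / M p" using M(2)[of p] by simp
      moreover have "\<rho> ^ p / M p \<le> c / a"
        using le[of p] a M(2)[of p] by (simp add: field_simps)
      ultimately show ?thesis using a ac by (simp add: ln_mono)
    qed
    then show "max 0 (ln (\<rho> ^ p / M p)) \<le> ln (c / a)" using a ac by simp
  qed simp
  then have "exp (assoc_fun M \<rho>) \<le> c / a"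
    using a ac by (metis divide_pos_pos exp_ln exp_le_cancel_iff less_le_trans)
  then show ?thesis using a by (simp add: field_simps)
qed

text \<open>The term p = 0 is ln 1, and the terms p > 0 are ln 0, which is 0 by convention. It makes
  k = 0 an admissible growth parameter with exponential factor 1.\<close>

lemma assoc_fun_0: "M 0 = 1 \<Longrightarrow> assoc_fun M 0 = 0"
proof -
  assume "M 0 = 1"
  then have "max 0 (ln (0 ^ p / M p)) = 0" for p by (cases p) auto
  then show ?thesis by (simp add: assoc_fun_def)
qed

text \<open>Trades a spare factor (1 + |x|^2)^d for the integrable weight; the comparison is made in
  each of the d factors separately.\<close>

lemma wt_ge: "wt (x::'a::euclidean_space) * (1 + (norm x)\<^sup>2) ^ DIM('a) \<ge> 1"
proof -
  have "(1::real) = (\<Prod>b\<in>(Basis::'a set). 1)" by simp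
  also have "\<dots> \<le> (\<Prod>b\<in>Basis. 1 / (1 + (x \<bullet> b)\<^sup>2) * (1 + (norm x)\<^sup>2))"
  proof (intro prod_mono conjI)
    fix b :: 'a assume "b \<in> Basis"
    then have "(x \<bullet> b)\<^sup>2 \<le> (norm x)\<^sup>2"
      using Basis_le_norm[of b x] by (metis abs_ge_zero power2_abs power_mono)
    moreover have "0 < 1 + (x \<bullet> b)\<^sup>2" by (simp add: add_pos_nonneg)
    ultimately show "1 \<le> 1 / (1 + (x \<bullet> b)\<^sup>2) * (1 + (norm x)\<^sup>2)" by (simp add: field_simps)
  qed simp
  also have "\<dots> = wt x * (1 + (norm x)\<^sup>2) ^ DIM('a)"
    by (simp only: wt_def prod.distrib prod_constant)
  finally show ?thesis .
qed

lemma one_plus_power_le: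
  assumes "r \<ge> (0::real)" shows "(1 + r) ^ d \<le> 2 ^ d * (1 + r ^ d)"
proof -
  have "(1 + r) ^ d \<le> (2 * max 1 r) ^ d" using assms by (intro power_mono) auto
  also have "\<dots> = 2 ^ d * max 1 r ^ d" by (simp add: power_mult_distrib)
  also have "\<dots> \<le> 2 ^ d * (1 + r ^ d)" using assms by (intro mult_left_mono) (auto simp: max_def)
  finally show ?thesis .
qed

text \<open>Integration by parts in one direction controls powers of a single coordinate. The
  largest coordinate recovers the norm at the cost of a factor d.\<close>

lemma norm_le_card_component:
  fixes x :: "real^'n::finite"
  obtains j where "norm x \<le> real CARD('n) * \<bar>x $ j\<bar>"
proof -
  obtain j where j: "\<And>i. \<bar>x $ i\<bar> \<le> \<bar>x $ j\<bar>"
  proof -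
    have "Max (range (\<lambda>i. \<bar>x $ i\<bar>)) \<in> range (\<lambda>i. \<bar>x $ i\<bar>)" by (intro Max_in) auto
    then obtain j where "Max (range (\<lambda>i. \<bar>x $ i\<bar>)) = \<bar>x $ j\<bar>" by (rule rangeE)
    moreover have "\<bar>x $ i\<bar> \<le> Max (range (\<lambda>i. \<bar>x $ i\<bar>))" for i by (intro Max_ge) auto
    ultimately show ?thesis by (intro that) auto
  qed
  have "norm x \<le> (\<Sum>i\<in>UNIV. \<bar>x $ i\<bar>)" by (rule norm_le_l1_cart)
  also have "\<dots> \<le> (\<Sum>i\<in>(UNIV::'n set). \<bar>x $ j\<bar>)" by (intro sum_mono j)
  finally show ?thesis by (intro that[of j]) simp
qed

text \<open>The hypothesis is used at the exponents p and p + 2d. By (M.2), M_(p+2d) is at most c0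
  H^(p+2d) M_p M_(2d), so a polynomial factor of degree 2d in |\<eta>| costs a constant and H^p; the
  power H^p is absorbed by k^p because k d H \<le> h.\<close>

lemma assoc_fun_decay:
  fixes M :: "nat \<Rightarrow> real"
  assumes "weight_seq M"
  obtains H where "H \<ge> 1" 
    "\<And>h. h > 0 \<Longrightarrow> \<exists>C\<ge>0. \<forall>(k::real) (\<eta>::real^'n::finite) b A. 
        0 \<le> k \<longrightarrow> k * CARD('n) * H \<le> h \<longrightarrow> 0 \<le> b \<longrightarrow> (\<forall>p j. h ^ p * (\<bar>\<eta> $ j\<bar> ^ p * b) \<le> A * M p) \<longrightarrow>
        exp (assoc_fun M (k * norm \<eta>)) * b \<le> C * A * wt \<eta>"
proof -
  let ?d = "CARD('n)"
  from assms obtain c0 H where M: "M 0 = 1" "\<And>p. M p > 0" and cH: "c0 \<ge> 1" "H \<ge> 1"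
    and m2: "\<And>p q. q \<le> p \<Longrightarrow> M p \<le> c0 * H ^ p * (M (p - q) * M q)"
    unfolding weight_seq_def by blast
  have "\<exists>C\<ge>0. \<forall>(k::real) (\<eta>::real^'n::finite) b A. 
        0 \<le> k \<longrightarrow> k * ?d * H \<le> h \<longrightarrow> 0 \<le> b \<longrightarrow> (\<forall>p j. h ^ p * (\<bar>\<eta> $ j\<bar> ^ p * b) \<le> A * M p) \<longrightarrow>
        exp (assoc_fun M (k * norm \<eta>)) * b \<le> C * A * wt \<eta>" if h: "h > 0" for h
  proof -
    define D where "D = real ?d / h"
    \<comment> \<open>Read off from the final estimate: 2^d comes from expanding (1 + r^2)^d, the
      summand 1 from the exponent p, and the other summand from the exponent p + 2d after
      (M.2).\<close>
    define C where "C = 2 ^ ?d * (1 + c0 * (D * H) ^ (2 * ?d) * M (2 * ?d))"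
    have D: "D > 0" using h by (simp add: D_def)
    have "C \<ge> 0" using cH D less_imp_le[OF M(2)] by (auto simp: C_def intro!: mult_nonneg_nonneg add_nonneg_nonneg)
    moreover have "exp (assoc_fun M (k * norm \<eta>)) * b \<le> C * A * wt \<eta>"
      if k: "0 \<le> k" "k * ?d * H \<le> h" and b: "0 \<le> b" and le: "\<And>p j. h ^ p * (\<bar>\<eta> $ j\<bar> ^ p * b) \<le> A * M p"
      for k b A :: real and \<eta> :: "real^'n"
    proof -
      define r where "r = norm \<eta>"
      have r: "r \<ge> 0" by (simp add: r_def)
      \<comment> \<open>At p = 0 the power of the coordinate is 1, so any index serves, in
        particular \<open>undefined\<close>; the hypothesis then reads b \<le> A.\<close>
      have A: "A \<ge> 0" using le[of 0 undefined] M(1) b by simp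
      have kD: "k * D * H \<le> 1" using k h by (simp add: D_def field_simps)
      have kD0: "0 \<le> k * D * H" using k D cH by simp
      have kD1: "k * D \<le> 1"
        using kD mult_left_mono[OF cH(2), of "k * D"] k D by simp
      obtain j where j: "norm \<eta> \<le> real ?d * \<bar>\<eta> $ j\<bar>" by (rule norm_le_card_component)
      have rp: "r ^ p * b \<le> D ^ p * (A * M p)" for p
      proof -
        have "r ^ p * b \<le> (real ?d * \<bar>\<eta> $ j\<bar>) ^ p * b"
          using j r b by (intro mult_right_mono power_mono) (auto simp: r_def)
        also have "\<dots> = D ^ p * (h ^ p * (\<bar>\<eta> $ j\<bar> ^ p * b))"
          using h by (simp add: D_def power_mult_distrib power_divide)
        also have "\<dots> \<le> D ^ p * (A * M p)" using le D by (intro mult_left_mono) auto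
        finally show ?thesis .
      qed
      \<comment> \<open>The supremum is compared with b already multiplied by the polynomial factor,
        which \<open>wt_ge\<close> afterwards exchanges for \<open>wt \<eta>\<close>.\<close>
      have "exp (assoc_fun M (k * r)) * (b * (1 + r\<^sup>2) ^ ?d) \<le> C * A"
      proof (rule exp_assoc_fun_le[where M=M, OF M])
        fix p
        have "(k * r) ^ p * (b * (1 + r\<^sup>2) ^ ?d) \<le> (k * r) ^ p * (b * (2 ^ ?d * (1 + (r\<^sup>2) ^ ?d)))"
          using k r b by (intro mult_left_mono one_plus_power_le) auto
        also have "\<dots> = 2 ^ ?d * (k ^ p * (r ^ p * b) + k ^ p * (r ^ (p + 2 * ?d) * b))"
          unfolding power_add power_mult power_mult_distrib by (simp add: algebra_simps)
        also have "\<dots> \<le> 2 ^ ?d * (k ^ p * (D ^ p * (A * M p)) + k ^ p * (D ^ (p + 2 * ?d) * (A * M (p + 2 * ?d))))"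
          using k by (intro mult_left_mono add_mono rp) auto
        also have "\<dots> \<le> 2 ^ ?d * (k ^ p * (D ^ p * (A * M p)) 
            + k ^ p * (D ^ (p + 2 * ?d) * (A * (c0 * H ^ (p + 2 * ?d) * (M p * M (2 * ?d))))))"
          using k D A m2[of "2 * ?d" "p + 2 * ?d"] by (intro mult_left_mono add_mono) auto
        also have "\<dots> = 2 ^ ?d * (A * M p) * ((k * D) ^ p + (k * D * H) ^ p * (c0 * (D * H) ^ (2 * ?d) * M (2 * ?d)))"
          by (simp add: power_mult_distrib power_add algebra_simps)
        also have "\<dots> \<le> 2 ^ ?d * (A * M p) * (1 + 1 * (c0 * (D * H) ^ (2 * ?d) * M (2 * ?d)))"
          using A M(2) cH D k kD kD0 kD1
          by (intro mult_left_mono add_mono mult_right_mono power_le_one mult_nonneg_nonneg) (auto intro: less_imp_le)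
        also have "\<dots> = C * A * M p" by (simp add: C_def)
        finally show "(k * r) ^ p * (b * (1 + r\<^sup>2) ^ ?d) \<le> C * A * M p" .
      qed (use k r b in auto)
      then have "exp (assoc_fun M (k * r)) * (b * (1 + r\<^sup>2) ^ ?d) * wt \<eta> \<le> C * A * wt \<eta>"
        by (intro mult_right_mono) (auto intro: less_imp_le wt_pos)
      moreover have "exp (assoc_fun M (k * r)) * b * 1 \<le> exp (assoc_fun M (k * r)) * b * (wt \<eta> * (1 + r\<^sup>2) ^ ?d)"
        using wt_ge[of \<eta>] b by (intro mult_left_mono) (auto simp: r_def)
      ultimately show ?thesis by (simp add: r_def mult_ac)
    qed
    ultimately show ?thesis by blast
  qed
  then show ?thesis using cH by (intro that[of H]) auto
qed

section \<open>Derivative families and the Laplace transform\<close>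

text \<open>Matches the shape of \<open>smooth_family\<close>, where every derivative is reached
  from the zero index by raising one entry at a time.\<close>

lemma multi_index_induct [case_names zero Suc]:
  fixes \<alpha> :: "'n::finite multi_index"
  assumes "P (\<lambda>_. 0)" "\<And>\<alpha> i. P \<alpha> \<Longrightarrow> P (\<alpha>(i := Suc (\<alpha> i)))"
  shows "P \<alpha>"
proof (induction "mi_len \<alpha>" arbitrary: \<alpha>)
  case 0
  then have "\<alpha> = (\<lambda>_. 0)" by (auto simp: mi_len_def)
  then show ?case using assms(1) by simp
next
  case (Suc n)
  have "\<exists>i. \<alpha> i \<noteq> 0"
  proof (rule ccontr)
    assume "\<not> (\<exists>i. \<alpha> i \<noteq> 0)"
    then show False using Suc(2) by (simp add: mi_len_def)
  qed
  then obtain i where i: "\<alpha> i \<noteq> 0" by blast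
  define \<beta> where "\<beta> = \<alpha>(i := \<alpha> i - 1)"
  have \<alpha>: "\<alpha> = \<beta>(i := Suc (\<beta> i))" using i by (auto simp: \<beta>_def)
  have "mi_len \<alpha> = \<alpha> i + sum \<alpha> (UNIV - {i})" "mi_len \<beta> = \<beta> i + sum \<beta> (UNIV - {i})"
    unfolding mi_len_def by (auto simp: sum.remove[of UNIV i])
  moreover have "sum \<beta> (UNIV - {i}) = sum \<alpha> (UNIV - {i})" by (intro sum.cong) (auto simp: \<beta>_def)
  ultimately have "n = mi_len \<beta>" using Suc(2) i by (simp add: \<beta>_def)
  from Suc(1)[OF this] show ?case by (subst \<alpha>) (rule assms(2))
qed

text \<open>Justifies the definite description in \<open>Dmi\<close>: the family is determined by
  its member at the zero index, since vector derivatives are unique.\<close>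

lemma smooth_family_unique:
  assumes "smooth_family \<phi> \<Phi>" "smooth_family \<phi> \<Psi>"
  shows "\<Phi> = \<Psi>"
proof
  fix \<alpha>
  show "\<Phi> \<alpha> = \<Psi> \<alpha>"
  proof (induction \<alpha> rule: multi_index_induct)
    case zero
    then show ?case using assms by (simp add: smooth_family_def)
  next
    case (Suc \<alpha> i)
    show ?case
    proof
      fix x
      have "((\<lambda>t. \<Phi> \<alpha> (x + t *\<^sub>R axis i 1)) has_vector_derivative \<Phi> (\<alpha>(i := Suc (\<alpha> i))) x) (at 0)"
        "((\<lambda>t. \<Psi> \<alpha> (x + t *\<^sub>R axis i 1)) has_vector_derivative \<Psi> (\<alpha>(i := Suc (\<alpha> i))) x) (at 0)"
        using assms by (auto simp: smooth_family_def)
      then show "\<Phi> (\<alpha>(i := Suc (\<alpha> i))) x = \<Psi> (\<alpha>(i := Suc (\<alpha> i))) x"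
        unfolding Suc by (rule vector_derivative_unique_at)
    qed
  qed
qed

lemma Dmi_eq:
  assumes "smooth_family \<phi> \<Phi>"
  shows "Dmi \<alpha> \<phi> = \<Phi> \<alpha>"
proof -
  have "(THE \<Phi>. smooth_family \<phi> \<Phi>) = \<Phi>"
    using assms smooth_family_unique by (intro the_equality) blast+
  then show ?thesis by (simp add: Dmi_def)
qed

lemma smooth_family_Dmi: "smooth \<phi> \<Longrightarrow> smooth_family \<phi> (\<lambda>\<alpha>. Dmi \<alpha> \<phi>)"
  unfolding smooth_def using Dmi_eq by (metis ext)

lemma smooth_imp_continuous: "smooth \<phi> \<Longrightarrow> continuous_on UNIV \<phi>"
  unfolding smooth_def smooth_family_def by metis

lemma Dmi_continuous: "smooth \<phi> \<Longrightarrow> continuous_on UNIV (Dmi \<alpha> \<phi>)"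
  using smooth_family_Dmi unfolding smooth_family_def by blast

lemma Dmi_0: "smooth \<phi> \<Longrightarrow> Dmi (\<lambda>_. 0) \<phi> = \<phi>"
  using smooth_family_Dmi unfolding smooth_family_def by blast

text \<open>The complement of the support is open, so a coordinate line through x stays in it for
  small t, and the next derivative is that of a locally zero function.\<close>

lemma Dmi_eq_0:
  assumes "smooth \<phi>" "x \<notin> supp \<phi>"
  shows "Dmi \<alpha> \<phi> x = 0"
proof -
  have "\<forall>x. x \<notin> supp \<phi> \<longrightarrow> Dmi \<alpha> \<phi> x = 0"
  proof (induction \<alpha> rule: multi_index_induct)
    case zero
    show ?case using closure_subset[of "{x. \<phi> x \<noteq> 0}"] by (auto simp: Dmi_0[OF assms(1)] supp_def)
  next
    case (Suc \<alpha> i)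
    show ?case
    proof (intro allI impI)
      fix x assume x: "x \<notin> supp \<phi>"
      have d: "((\<lambda>t. Dmi \<alpha> \<phi> (x + t *\<^sub>R axis i 1)) has_vector_derivative Dmi (\<alpha>(i := Suc (\<alpha> i))) \<phi> x) (at 0)"
        using smooth_family_Dmi[OF assms(1)] by (auto simp: smooth_family_def)
      have "open (- supp \<phi>)" unfolding supp_def by (rule open_Compl[OF closed_closure])
      then have "open ((\<lambda>t::real. x + t *\<^sub>R axis i 1) -` (- supp \<phi>))"
        by (rule continuous_open_vimage) (intro continuous_intros)
      moreover have "0 \<in> (\<lambda>t::real. x + t *\<^sub>R axis i 1) -` (- supp \<phi>)" using x by simp
      ultimately have "((\<lambda>t. 0) has_vector_derivative Dmi (\<alpha>(i := Suc (\<alpha> i))) \<phi> x) (at 0)"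
        by (rule has_vector_derivative_transform_within_open[OF d]) (use Suc in auto)
      then show "Dmi (\<alpha>(i := Suc (\<alpha> i))) \<phi> x = 0"
        using has_vector_derivative_const vector_derivative_unique_at by blast
    qed
  qed
  then show ?thesis using assms(2) by blast
qed

text \<open>The Laplace transform at \<zeta> = \<xi> + i\<eta>. Real and imaginary parts are
  separate arguments because \<xi> ranges over a base set or a ball while \<eta> is integrated over
  the whole space.\<close>

definition lap :: "(real^'n::finite \<Rightarrow> complex) \<Rightarrow> real^'n \<Rightarrow> real^'n \<Rightarrow> complex" where
  "lap \<phi> \<xi> \<eta> = integral\<^sup>L lborel (\<lambda>x. exp (of_real (x \<bullet> \<xi>) + \<i> * of_real (x \<bullet> \<eta>)) * \<phi> x)"

lemma integrable_lap:
  fixes \<phi> :: "real^'n::finite \<Rightarrow> complex"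
  assumes "continuous_on UNIV \<phi>" "integrable lborel (\<lambda>x. exp (x \<bullet> \<xi>) * norm (\<phi> x))"
  shows "integrable lborel (\<lambda>x. exp (of_real (x \<bullet> \<xi>) + \<i> * of_real (x \<bullet> \<eta>)) * \<phi> x)"
proof (rule Bochner_Integration.integrable_bound[OF assms(2)])
  show "(\<lambda>x. exp (of_real (x \<bullet> \<xi>) + \<i> * of_real (x \<bullet> \<eta>)) * \<phi> x) \<in> borel_measurable lborel"
    unfolding measurable_lborel2
    by (intro borel_measurable_continuous_onI continuous_intros assms(1))
qed (simp add: norm_mult)

lemma norm_lap_le:
  fixes \<phi> :: "real^'n::finite \<Rightarrow> complex"
  shows "norm (lap \<phi> \<xi> \<eta>) \<le> (\<integral>x. exp (x \<bullet> \<xi>) * norm (\<phi> x) \<partial>lborel)"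
proof -
  have "norm (lap \<phi> \<xi> \<eta>) \<le> (\<integral>x. norm (exp (of_real (x \<bullet> \<xi>) + \<i> * of_real (x \<bullet> \<eta>)) * \<phi> x) \<partial>lborel)"
    unfolding lap_def by (rule integral_norm_bound)
  then show ?thesis by (simp add: norm_mult)
qed

text \<open>The derivative of e^(x\<zeta>) \<phi>(x) in direction j has integral 0. Only weighted
  integrability enters, so the lemma covers compact support as well as rapid decrease at \<xi> =
  0.\<close>

lemma lap_by_parts:
  fixes \<phi> \<phi>' :: "real^'n::finite \<Rightarrow> complex"
  assumes d: "\<And>x. ((\<lambda>t. \<phi> (x + t *\<^sub>R axis j 1)) has_vector_derivative \<phi>' x) (at 0)"
    and c: "continuous_on UNIV \<phi>" "continuous_on UNIV \<phi>'"
    and i: "integrable lborel (\<lambda>x. exp (x \<bullet> \<xi>) * norm (\<phi> x))" "integrable lborel (\<lambda>x. exp (x \<bullet> \<xi>) * norm (\<phi>' x))"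
  shows "Complex (\<xi> $ j) (\<eta> $ j) * lap \<phi> \<xi> \<eta> = - lap \<phi>' \<xi> \<eta>"
proof -
  define E where "E x = exp (complex_of_real (x \<bullet> \<xi>) + \<i> * of_real (x \<bullet> \<eta>))" for x
  have Ed: "((\<lambda>t. E (x + t *\<^sub>R axis j 1)) has_vector_derivative (Complex (\<xi> $ j) (\<eta> $ j) * E x)) (at 0)" for x
  proof -
    have "((\<lambda>t::real. complex_of_real (x \<bullet> \<xi> + t * (\<xi> $ j)) + \<i> * of_real (x \<bullet> \<eta> + t * (\<eta> $ j))) 
        has_vector_derivative Complex (\<xi> $ j) (\<eta> $ j)) (at 0)"
      by (auto intro!: derivative_eq_intros simp: Complex_eq)
    from field_vector_diff_chain_at[OF this DERIV_exp]
    show ?thesis by (simp add: E_def o_def inner_add_left inner_axis')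
  qed
  have iE: "integrable lborel (\<lambda>x. E x * \<phi> x)" "integrable lborel (\<lambda>x. E x * \<phi>' x)"
    unfolding E_def by (intro integrable_lap c i)+
  have "integral\<^sup>L lborel (\<lambda>x. Complex (\<xi> $ j) (\<eta> $ j) * (E x * \<phi> x) + E x * \<phi>' x) = 0"
  proof (rule integral_directional_derivative_eq_0[where e = "axis j 1" and g="\<lambda>x. E x * \<phi> x"])
    show "((\<lambda>t. E (x + t *\<^sub>R axis j 1) * \<phi> (x + t *\<^sub>R axis j 1)) has_vector_derivative
        Complex (\<xi> $ j) (\<eta> $ j) * (E x * \<phi> x) + E x * \<phi>' x) (at 0)" for x
      using has_vector_derivative_mult[OF Ed[of x] d[of x]] by (simp add: algebra_simps)
    show "continuous_on UNIV (\<lambda>x. Complex (\<xi> $ j) (\<eta> $ j) * (E x * \<phi> x) + E x * \<phi>' x)"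
      unfolding E_def by (intro continuous_intros c)
  qed (use iE in auto)
  then have "Complex (\<xi> $ j) (\<eta> $ j) * integral\<^sup>L lborel (\<lambda>x. E x * \<phi> x) + integral\<^sup>L lborel (\<lambda>x. E x * \<phi>' x) = 0"
    using iE by (subst (asm) Bochner_Integration.integral_add) auto
  then show ?thesis by (simp add: lap_def E_def add_eq_0_iff)
qed

definition single_mi :: "'n \<Rightarrow> nat \<Rightarrow> 'n::finite multi_index" where
  "single_mi j p = (\<lambda>i. if i = j then p else 0)"

lemma mi_len_single: "mi_len (single_mi j p) = p"
  unfolding mi_len_def single_mi_def by (subst sum.delta) auto

text \<open>Iterated integration by parts produces powers of the full coordinate \<zeta>_j; its
  modulus is at least |\<eta>_j|, whatever the real part.\<close>

lemma lap_decay_power: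
  fixes \<phi> :: "real^'n::finite \<Rightarrow> complex"
  assumes s: "smooth \<phi>" and i: "\<And>\<alpha>. integrable lborel (\<lambda>x. exp (x \<bullet> \<xi>) * norm (Dmi \<alpha> \<phi> x))"
  shows "\<bar>\<eta> $ j\<bar> ^ p * norm (lap \<phi> \<xi> \<eta>) \<le> (\<integral>x. exp (x \<bullet> \<xi>) * norm (Dmi (single_mi j p) \<phi> x) \<partial>lborel)"
proof -
  have "Complex (\<xi> $ j) (\<eta> $ j) ^ p * lap \<phi> \<xi> \<eta> = (-1) ^ p * lap (Dmi (single_mi j p) \<phi>) \<xi> \<eta>"
  proof (induction p)
    case 0
    have "single_mi j 0 = (\<lambda>_::'n. 0)" by (auto simp: single_mi_def)
    then show ?case by (simp add: Dmi_0[OF s])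
  next
    case (Suc p)
    let ?\<alpha> = "single_mi j p :: 'n multi_index"
    have "((\<lambda>t. Dmi ?\<alpha> \<phi> (x + t *\<^sub>R axis j 1)) has_vector_derivative Dmi (?\<alpha>(j := Suc (?\<alpha> j))) \<phi> x) (at 0)" for x
      using smooth_family_Dmi[OF s] unfolding smooth_family_def by blast
    moreover have "?\<alpha>(j := Suc (?\<alpha> j)) = single_mi j (Suc p)" by (auto simp: single_mi_def)
    ultimately have "((\<lambda>t. Dmi ?\<alpha> \<phi> (x + t *\<^sub>R axis j 1)) has_vector_derivative Dmi (single_mi j (Suc p)) \<phi> x) (at 0)" for x
      by simp
    then have *: "Complex (\<xi> $ j) (\<eta> $ j) * lap (Dmi ?\<alpha> \<phi>) \<xi> \<eta> = - lap (Dmi (single_mi j (Suc p)) \<phi>) \<xi> \<eta>"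
      by (rule lap_by_parts) (intro Dmi_continuous s i)+
    show ?case
      unfolding power_Suc mult.assoc Suc.IH mult.left_commute[of "Complex _ _" "(-1) ^ p"] * by simp
  qed
  from arg_cong[OF this, of norm] have "norm (Complex (\<xi> $ j) (\<eta> $ j)) ^ p * norm (lap \<phi> \<xi> \<eta>) = norm (lap (Dmi (single_mi j p) \<phi>) \<xi> \<eta>)"
    by (simp only: norm_mult norm_power norm_minus_cancel norm_one power_one mult_1)
  then have "norm (Complex (\<xi> $ j) (\<eta> $ j)) ^ p * norm (lap \<phi> \<xi> \<eta>) \<le>
      (\<integral>x. exp (x \<bullet> \<xi>) * norm (Dmi (single_mi j p) \<phi> x) \<partial>lborel)"
    by (simp only: norm_lap_le)
  moreover have "\<bar>\<eta> $ j\<bar> ^ p * norm (lap \<phi> \<xi> \<eta>) \<le> norm (Complex (\<xi> $ j) (\<eta> $ j)) ^ p * norm (lap \<phi> \<xi> \<eta>)"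
    using abs_Im_le_cmod[of "Complex (\<xi> $ j) (\<eta> $ j)"] by (intro mult_right_mono power_mono) auto
  ultimately show ?thesis by (rule order_trans[rotated])
qed

text \<open>Hypotheses on weighted L1 norms of derivatives are the common ground of the two function
  spaces: \<open>DK_bound\<close> yields them for every \<xi>, \<open>sigma_bound\<close> for \<xi>
  = 0.\<close>

lemma lap_decay:
  fixes M :: "nat \<Rightarrow> real"
  assumes "weight_seq M"
  obtains H where "H \<ge> 1" 
    "\<And>h. h > 0 \<Longrightarrow> \<exists>C\<ge>0. \<forall>(k::real) (\<phi>::real^'n::finite \<Rightarrow> complex) \<xi> \<eta> A. 
        0 \<le> k \<longrightarrow> k * CARD('n) * H \<le> h \<longrightarrow> smooth \<phi> \<longrightarrow>
        (\<forall>\<alpha>. integrable lborel (\<lambda>x. exp (x \<bullet> \<xi>) * norm (Dmi \<alpha> \<phi> x))) \<longrightarrow>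
        (\<forall>\<alpha>. h ^ mi_len \<alpha> * (\<integral>x. exp (x \<bullet> \<xi>) * norm (Dmi \<alpha> \<phi> x) \<partial>lborel) \<le> A * M (mi_len \<alpha>)) \<longrightarrow>
        exp (assoc_fun M (k * norm \<eta>)) * norm (lap \<phi> \<xi> \<eta>) \<le> C * A * wt \<eta>"
proof -
  obtain H where H: "H \<ge> 1" and dec: "\<And>h. h > 0 \<Longrightarrow> \<exists>C\<ge>0. \<forall>(k::real) (\<eta>::real^'n::finite) b A. 
        0 \<le> k \<longrightarrow> k * CARD('n) * H \<le> h \<longrightarrow> 0 \<le> b \<longrightarrow> (\<forall>p j. h ^ p * (\<bar>\<eta> $ j\<bar> ^ p * b) \<le> A * M p) \<longrightarrow>
        exp (assoc_fun M (k * norm \<eta>)) * b \<le> C * A * wt \<eta>"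
    using assoc_fun_decay[OF assms, where 'n='n] by metis
  show ?thesis
  proof (rule that[OF H])
    fix h :: real assume h: "h > 0"
    from dec[OF h] obtain C where "C \<ge> 0" and C: "\<And>(k::real) (\<eta>::real^'n::finite) b A. 
        0 \<le> k \<Longrightarrow> k * CARD('n) * H \<le> h \<Longrightarrow> 0 \<le> b \<Longrightarrow> (\<forall>p j. h ^ p * (\<bar>\<eta> $ j\<bar> ^ p * b) \<le> A * M p) \<Longrightarrow>
        exp (assoc_fun M (k * norm \<eta>)) * b \<le> C * A * wt \<eta>" by blast
    show "\<exists>C\<ge>0. \<forall>(k::real) (\<phi>::real^'n::finite \<Rightarrow> complex) \<xi> \<eta> A. 
        0 \<le> k \<longrightarrow> k * CARD('n) * H \<le> h \<longrightarrow> smooth \<phi> \<longrightarrow>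
        (\<forall>\<alpha>. integrable lborel (\<lambda>x. exp (x \<bullet> \<xi>) * norm (Dmi \<alpha> \<phi> x))) \<longrightarrow>
        (\<forall>\<alpha>. h ^ mi_len \<alpha> * (\<integral>x. exp (x \<bullet> \<xi>) * norm (Dmi \<alpha> \<phi> x) \<partial>lborel) \<le> A * M (mi_len \<alpha>)) \<longrightarrow>
        exp (assoc_fun M (k * norm \<eta>)) * norm (lap \<phi> \<xi> \<eta>) \<le> C * A * wt \<eta>"
    proof (intro exI[of _ C] conjI \<open>C \<ge> 0\<close> allI impI, rule C)
      fix k A :: real and \<phi> :: "real^'n \<Rightarrow> complex" and \<xi> \<eta> :: "real^'n"
      assume s: "smooth \<phi>" and i: "\<forall>\<alpha>. integrable lborel (\<lambda>x. exp (x \<bullet> \<xi>) * norm (Dmi \<alpha> \<phi> x))"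
        and b: "\<forall>\<alpha>. h ^ mi_len \<alpha> * (\<integral>x. exp (x \<bullet> \<xi>) * norm (Dmi \<alpha> \<phi> x) \<partial>lborel) \<le> A * M (mi_len \<alpha>)"
      show "\<forall>p j. h ^ p * (\<bar>\<eta> $ j\<bar> ^ p * norm (lap \<phi> \<xi> \<eta>)) \<le> A * M p"
      proof (intro allI)
        fix p j
        have "h ^ p * (\<bar>\<eta> $ j\<bar> ^ p * norm (lap \<phi> \<xi> \<eta>)) 
            \<le> h ^ p * (\<integral>x. exp (x \<bullet> \<xi>) * norm (Dmi (single_mi j p) \<phi> x) \<partial>lborel)"
          using h i by (intro mult_left_mono lap_decay_power s) auto
        also have "\<dots> \<le> A * M p" using spec[OF b, of "single_mi j p"] by (simp only: mi_len_single)
        finally show "h ^ p * (\<bar>\<eta> $ j\<bar> ^ p * norm (lap \<phi> \<xi> \<eta>)) \<le> A * M p" .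
      qed
    qed auto
  qed
qed

section \<open>From the defining bounds of the two function spaces to decay of the transform\<close>

lemma sigma_bound_pointwise:
  fixes \<phi> :: "real^'n::finite \<Rightarrow> complex"
  assumes "m > 0" "sigma_bound M m A \<phi>"
  shows "m ^ mi_len \<alpha> * norm (Dmi \<alpha> \<phi> x) \<le> A * (M (2 * CARD('n)) / m ^ (2 * CARD('n))) * M (mi_len \<alpha>) * wt x"
proof -
  let ?d = "CARD('n)"
  \<comment> \<open>The index \<beta> with all entries 2 is chosen for its length 2d: the
    corresponding power of \<open>japan x\<close> is the polynomial (1 + |x|^2)^d, which
    \<open>wt_ge\<close> turns into \<open>wt x\<close>.\<close>
  have len: "mi_len (\<lambda>_::'n. 2) = 2 * ?d" by (simp add: mi_len_def)
  have j: "japan x ^ (2 * ?d) = (1 + (norm x)\<^sup>2) ^ ?d"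
    by (simp add: japan_def power_mult)
  have "m ^ (mi_len \<alpha> + mi_len (\<lambda>_::'n. 2)) * japan x ^ mi_len (\<lambda>_::'n. 2) * norm (Dmi \<alpha> \<phi> x)
          \<le> A * (M (mi_len \<alpha>) * M (mi_len (\<lambda>_::'n. 2)))"
    using assms(2) unfolding sigma_bound_def by blast
  then have 1: "m ^ (2 * ?d) * (m ^ mi_len \<alpha> * norm (Dmi \<alpha> \<phi> x)) * (1 + (norm x)\<^sup>2) ^ ?d \<le> A * (M (mi_len \<alpha>) * M (2 * ?d))"
    unfolding len j by (simp add: power_add mult_ac)
  let ?y = "m ^ (2 * ?d) * (m ^ mi_len \<alpha> * norm (Dmi \<alpha> \<phi> x))"
  have "?y * 1 \<le> ?y * (wt x * (1 + (norm x)\<^sup>2) ^ ?d)"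
    using wt_ge[of x] assms(1) by (intro mult_left_mono) auto
  also have "\<dots> = (?y * (1 + (norm x)\<^sup>2) ^ ?d) * wt x" by (simp add: mult_ac)
  also have "\<dots> \<le> (A * (M (mi_len \<alpha>) * M (2 * ?d))) * wt x"
    by (rule mult_right_mono[OF 1]) (simp add: wt_pos less_imp_le)
  finally show ?thesis using assms(1) by (simp add: field_simps)
qed

lemma sigma_bound_integral:
  fixes \<phi> :: "real^'n::finite \<Rightarrow> complex"
  assumes m: "m > 0" "sigma_bound M m A \<phi>" and s: "smooth \<phi>"
  shows "integrable lborel (\<lambda>x. norm (Dmi \<alpha> \<phi> x))"
    and "m ^ mi_len \<alpha> * (\<integral>x. norm (Dmi \<alpha> \<phi> x) \<partial>lborel)
        \<le> A * (M (2 * CARD('n)) / m ^ (2 * CARD('n)) * integral\<^sup>L lborel (wt :: real^'n \<Rightarrow> real)) * M (mi_len \<alpha>)"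
proof -
  let ?B = "A * (M (2 * CARD('n)) / m ^ (2 * CARD('n))) * M (mi_len \<alpha>)"
  have b: "m ^ mi_len \<alpha> * norm (Dmi \<alpha> \<phi> x) \<le> ?B * wt x" for x
    using sigma_bound_pointwise[OF m] .
  have wi: "integrable lborel (\<lambda>x::real^'n. ?B * wt x)" by (intro integrable_mult_right integrable_wt)
  have "integrable lborel (\<lambda>x. m ^ mi_len \<alpha> * norm (Dmi \<alpha> \<phi> x))"
  proof (rule Bochner_Integration.integrable_bound[OF wi])
    show "(\<lambda>x. m ^ mi_len \<alpha> * norm (Dmi \<alpha> \<phi> x)) \<in> borel_measurable lborel"
      unfolding measurable_lborel2
      by (intro borel_measurable_continuous_onI continuous_intros Dmi_continuous s)
    show "AE x in lborel. norm (m ^ mi_len \<alpha> * norm (Dmi \<alpha> \<phi> x)) \<le> norm (?B * wt x)"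
    proof (rule AE_I2)
      fix x
      show "norm (m ^ mi_len \<alpha> * norm (Dmi \<alpha> \<phi> x)) \<le> norm (?B * wt x)"
        using order_trans[OF b[of x] abs_ge_self] m(1) by (simp add: abs_mult)
    qed
  qed
  then show i: "integrable lborel (\<lambda>x. norm (Dmi \<alpha> \<phi> x))" using m(1) by simp
  have "m ^ mi_len \<alpha> * (\<integral>x. norm (Dmi \<alpha> \<phi> x) \<partial>lborel) = (\<integral>x. m ^ mi_len \<alpha> * norm (Dmi \<alpha> \<phi> x) \<partial>lborel)"
    by (rule integral_mult_right_zero[symmetric])
  also have "\<dots> \<le> integral\<^sup>L lborel (\<lambda>x::real^'n. ?B * wt x)"
    by (rule integral_mono) (use i wi b in auto)
  also have "\<dots> = ?B * integral\<^sup>L lborel (wt :: real^'n \<Rightarrow> real)" by (rule integral_mult_right_zero)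
  finally show "m ^ mi_len \<alpha> * (\<integral>x. norm (Dmi \<alpha> \<phi> x) \<partial>lborel)
        \<le> A * (M (2 * CARD('n)) / m ^ (2 * CARD('n)) * integral\<^sup>L lborel (wt :: real^'n \<Rightarrow> real)) * M (mi_len \<alpha>)"
    by (simp add: mult_ac)
qed

text \<open>On \<open>K\<close> the exponential weight is at most exp (r R), and off
  \<open>K\<close> all derivatives vanish. The resulting factor depends on \<xi> only through
  R.\<close>

lemma DK_bound_integral:
  fixes \<phi> :: "real^'n::finite \<Rightarrow> complex"
  assumes h: "h > 0" "DK_bound M h A \<phi>" and s: "smooth \<phi>" and K: "compact K" "supp \<phi> \<subseteq> K"
    and r: "\<And>x. x \<in> K \<Longrightarrow> norm x \<le> r" and R: "norm \<xi> \<le> R" "0 \<le> R"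
  shows "integrable lborel (\<lambda>x. exp (x \<bullet> \<xi>) * norm (Dmi \<alpha> \<phi> x))"
    and "h ^ mi_len \<alpha> * (\<integral>x. exp (x \<bullet> \<xi>) * norm (Dmi \<alpha> \<phi> x) \<partial>lborel)
        \<le> A * (exp (r * R) * measure lborel K) * M (mi_len \<alpha>)"
proof -
  let ?B = "exp (r * R) * (A * M (mi_len \<alpha>))"
  have b: "h ^ mi_len \<alpha> * (exp (x \<bullet> \<xi>) * norm (Dmi \<alpha> \<phi> x)) \<le> ?B * indicat_real K x" for x
  proof (cases "x \<in> K")
    case True
    have "x \<bullet> \<xi> \<le> norm x * norm \<xi>" by (rule norm_cauchy_schwarz)
    also have "\<dots> \<le> r * R" using r[OF True] R by (intro mult_mono) (auto intro: order_trans[OF norm_ge_zero])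
    finally have e1: "exp (x \<bullet> \<xi>) \<le> exp (r * R)" by simp
    have e2: "h ^ mi_len \<alpha> * norm (Dmi \<alpha> \<phi> x) \<le> A * M (mi_len \<alpha>)"
      using h(2) unfolding DK_bound_def by blast
    have "exp (x \<bullet> \<xi>) * (h ^ mi_len \<alpha> * norm (Dmi \<alpha> \<phi> x)) \<le> ?B"
      by (rule mult_mono[OF e1 e2]) (use h(1) in auto)
    then show ?thesis using True by (simp add: mult_ac)
  next
    case False
    then have "Dmi \<alpha> \<phi> x = 0" using K(2) by (intro Dmi_eq_0[OF s]) auto
    then show ?thesis using False by simp
  qed
  have K': "K \<in> sets lborel" "emeasure lborel K < \<infinity>"
    using K(1) emeasure_bounded_finite[OF compact_imp_bounded[OF K(1)]] by (auto simp: borel_compact)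
  have wi: "integrable lborel (\<lambda>x. ?B * indicat_real K x)"
    using K' by (intro integrable_mult_right integrable_real_indicator) auto
  have "integrable lborel (\<lambda>x. h ^ mi_len \<alpha> * (exp (x \<bullet> \<xi>) * norm (Dmi \<alpha> \<phi> x)))"
  proof (rule Bochner_Integration.integrable_bound[OF wi])
    show "(\<lambda>x. h ^ mi_len \<alpha> * (exp (x \<bullet> \<xi>) * norm (Dmi \<alpha> \<phi> x))) \<in> borel_measurable lborel"
      unfolding measurable_lborel2
      by (intro borel_measurable_continuous_onI continuous_intros Dmi_continuous s)
    show "AE x in lborel. norm (h ^ mi_len \<alpha> * (exp (x \<bullet> \<xi>) * norm (Dmi \<alpha> \<phi> x))) \<le> norm (?B * indicat_real K x)"
    proof (rule AE_I2)
      fix x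
      show "norm (h ^ mi_len \<alpha> * (exp (x \<bullet> \<xi>) * norm (Dmi \<alpha> \<phi> x))) \<le> norm (?B * indicat_real K x)"
        using order_trans[OF b[of x] abs_ge_self] h(1) by (simp add: abs_mult)
    qed
  qed
  then show i: "integrable lborel (\<lambda>x. exp (x \<bullet> \<xi>) * norm (Dmi \<alpha> \<phi> x))" using h(1) by simp
  have "h ^ mi_len \<alpha> * (\<integral>x. exp (x \<bullet> \<xi>) * norm (Dmi \<alpha> \<phi> x) \<partial>lborel)
      = (\<integral>x. h ^ mi_len \<alpha> * (exp (x \<bullet> \<xi>) * norm (Dmi \<alpha> \<phi> x)) \<partial>lborel)"
    by (rule integral_mult_right_zero[symmetric])
  also have "\<dots> \<le> (\<integral>x. ?B * indicat_real K x \<partial>lborel)"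
    by (rule integral_mono) (use i wi b in auto)
  also have "\<dots> = ?B * measure lborel K" using K' by simp
  finally show "h ^ mi_len \<alpha> * (\<integral>x. exp (x \<bullet> \<xi>) * norm (Dmi \<alpha> \<phi> x) \<partial>lborel)
        \<le> A * (exp (r * R) * measure lborel K) * M (mi_len \<alpha>)"
    by (simp add: mult_ac)
qed

lemma weight_seq_pos: "weight_seq M \<Longrightarrow> M p > 0"
  by (simp add: weight_seq_def)

lemma weight_seq_0: "weight_seq M \<Longrightarrow> M 0 = 1"
  by (simp add: weight_seq_def)

lemma lap_decay_sigma:
  fixes M :: "nat \<Rightarrow> real"
  assumes M: "weight_seq M"
  obtains H where "H \<ge> 1" 
    "\<And>m. m > 0 \<Longrightarrow> \<exists>C\<ge>0. \<forall>(k::real) (\<phi>::real^'n::finite \<Rightarrow> complex) \<eta> A. 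
        0 \<le> k \<longrightarrow> k * CARD('n) * H \<le> m \<longrightarrow> smooth \<phi> \<and> sigma_bound M m A \<phi> \<longrightarrow>
        exp (assoc_fun M (k * norm \<eta>)) * norm (lap \<phi> 0 \<eta>) \<le> C * A * wt \<eta>"
proof (rule lap_decay[OF M, where 'n='n])
  fix H assume H: "H \<ge> 1" and dec: 
    "\<And>h. h > 0 \<Longrightarrow> \<exists>C\<ge>0. \<forall>(k::real) (\<phi>::real^'n::finite \<Rightarrow> complex) \<xi> \<eta> A. 
        0 \<le> k \<longrightarrow> k * CARD('n) * H \<le> h \<longrightarrow> smooth \<phi> \<longrightarrow>
        (\<forall>\<alpha>. integrable lborel (\<lambda>x. exp (x \<bullet> \<xi>) * norm (Dmi \<alpha> \<phi> x))) \<longrightarrow>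
        (\<forall>\<alpha>. h ^ mi_len \<alpha> * (\<integral>x. exp (x \<bullet> \<xi>) * norm (Dmi \<alpha> \<phi> x) \<partial>lborel) \<le> A * M (mi_len \<alpha>)) \<longrightarrow>
        exp (assoc_fun M (k * norm \<eta>)) * norm (lap \<phi> \<xi> \<eta>) \<le> C * A * wt \<eta>"
  show ?thesis
  proof (rule that[OF H])
    fix m :: real assume m: "m > 0"
    define L where "L = M (2 * CARD('n)) / m ^ (2 * CARD('n)) * integral\<^sup>L lborel (wt :: real^'n \<Rightarrow> real)"
    have L: "L \<ge> 0" using weight_seq_pos[OF M, of "2 * CARD('n)"] m
      by (auto simp: L_def intro!: mult_nonneg_nonneg divide_nonneg_nonneg integral_nonneg_AE less_imp_le[OF wt_pos])
    from dec[OF m] obtain C where C0: "C \<ge> 0" and C: "\<And>(k::real) (\<phi>::real^'n::finite \<Rightarrow> complex) \<xi> \<eta> A. 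
        0 \<le> k \<Longrightarrow> k * CARD('n) * H \<le> m \<Longrightarrow> smooth \<phi> \<Longrightarrow>
        (\<forall>\<alpha>. integrable lborel (\<lambda>x. exp (x \<bullet> \<xi>) * norm (Dmi \<alpha> \<phi> x))) \<Longrightarrow>
        (\<forall>\<alpha>. m ^ mi_len \<alpha> * (\<integral>x. exp (x \<bullet> \<xi>) * norm (Dmi \<alpha> \<phi> x) \<partial>lborel) \<le> A * M (mi_len \<alpha>)) \<Longrightarrow>
        exp (assoc_fun M (k * norm \<eta>)) * norm (lap \<phi> \<xi> \<eta>) \<le> C * A * wt \<eta>" by blast
    have "exp (assoc_fun M (k * norm \<eta>)) * norm (lap \<phi> 0 \<eta>) \<le> C * (A * L) * wt \<eta>"
      if "0 \<le> k" "k * CARD('n) * H \<le> m" "smooth \<phi>" "sigma_bound M m A \<phi>" 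
      for k A :: real and \<phi> :: "real^'n \<Rightarrow> complex" and \<eta> :: "real^'n"
      by (rule C) (use that sigma_bound_integral[OF m that(4,3)] in \<open>auto simp: L_def\<close>)
    then show "\<exists>C\<ge>0. \<forall>(k::real) (\<phi>::real^'n::finite \<Rightarrow> complex) \<eta> A. 
        0 \<le> k \<longrightarrow> k * CARD('n) * H \<le> m \<longrightarrow> smooth \<phi> \<and> sigma_bound M m A \<phi> \<longrightarrow>
        exp (assoc_fun M (k * norm \<eta>)) * norm (lap \<phi> 0 \<eta>) \<le> C * A * wt \<eta>"
      using C0 L by (intro exI[of _ "C * L"]) (auto simp: mult_ac)
  qed
qed

text \<open>Uniformity over all \<xi> of norm at most R supplies the majorant for the contour shift,
  where the real part moves.\<close>

lemma lap_decay_DK: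
  fixes M :: "nat \<Rightarrow> real" and K :: "(real^'n::finite) set"
  assumes M: "weight_seq M" and K: "compact K" and R: "0 \<le> R"
  obtains H where "H \<ge> 1" 
    "\<And>h. h > 0 \<Longrightarrow> \<exists>C\<ge>0. \<forall>(k::real) (\<phi>::real^'n::finite \<Rightarrow> complex) \<xi> \<eta> A. 
        0 \<le> k \<longrightarrow> k * CARD('n) * H \<le> h \<longrightarrow> 
        smooth \<phi> \<and> supp \<phi> \<subseteq> K \<and> DK_bound M h A \<phi> \<and> norm \<xi> \<le> R \<longrightarrow>
        exp (assoc_fun M (k * norm \<eta>)) * norm (lap \<phi> \<xi> \<eta>) \<le> C * A * wt \<eta>"
proof (rule lap_decay[OF M, where 'n='n])
  fix H assume H: "H \<ge> 1" and dec: 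
    "\<And>h. h > 0 \<Longrightarrow> \<exists>C\<ge>0. \<forall>(k::real) (\<phi>::real^'n::finite \<Rightarrow> complex) \<xi> \<eta> A. 
        0 \<le> k \<longrightarrow> k * CARD('n) * H \<le> h \<longrightarrow> smooth \<phi> \<longrightarrow>
        (\<forall>\<alpha>. integrable lborel (\<lambda>x. exp (x \<bullet> \<xi>) * norm (Dmi \<alpha> \<phi> x))) \<longrightarrow>
        (\<forall>\<alpha>. h ^ mi_len \<alpha> * (\<integral>x. exp (x \<bullet> \<xi>) * norm (Dmi \<alpha> \<phi> x) \<partial>lborel) \<le> A * M (mi_len \<alpha>)) \<longrightarrow>
        exp (assoc_fun M (k * norm \<eta>)) * norm (lap \<phi> \<xi> \<eta>) \<le> C * A * wt \<eta>"
  obtain r where r: "\<And>x. x \<in> K \<Longrightarrow> norm x \<le> r"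
    using compact_imp_bounded[OF K] unfolding bounded_iff by blast
  show ?thesis
  proof (rule that[OF H])
    fix h :: real assume h: "h > 0"
    define L where "L = exp (r * R) * measure lborel K"
    have L: "L \<ge> 0" by (simp add: L_def)
    from dec[OF h] obtain C where C0: "C \<ge> 0" and C: "\<And>(k::real) (\<phi>::real^'n::finite \<Rightarrow> complex) \<xi> \<eta> A. 
        0 \<le> k \<Longrightarrow> k * CARD('n) * H \<le> h \<Longrightarrow> smooth \<phi> \<Longrightarrow>
        (\<forall>\<alpha>. integrable lborel (\<lambda>x. exp (x \<bullet> \<xi>) * norm (Dmi \<alpha> \<phi> x))) \<Longrightarrow>
        (\<forall>\<alpha>. h ^ mi_len \<alpha> * (\<integral>x. exp (x \<bullet> \<xi>) * norm (Dmi \<alpha> \<phi> x) \<partial>lborel) \<le> A * M (mi_len \<alpha>)) \<Longrightarrow>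
        exp (assoc_fun M (k * norm \<eta>)) * norm (lap \<phi> \<xi> \<eta>) \<le> C * A * wt \<eta>" by blast
    have "exp (assoc_fun M (k * norm \<eta>)) * norm (lap \<phi> \<xi> \<eta>) \<le> C * (A * L) * wt \<eta>"
      if "0 \<le> k" "k * CARD('n) * H \<le> h" "smooth \<phi>" "supp \<phi> \<subseteq> K" "DK_bound M h A \<phi>" "norm \<xi> \<le> R" 
      for k A :: real and \<phi> :: "real^'n \<Rightarrow> complex" and \<xi> \<eta> :: "real^'n"
      by (rule C) (use that DK_bound_integral[OF h that(5,3) K that(4) r that(6) R] in \<open>auto simp: L_def\<close>)
    then show "\<exists>C\<ge>0. \<forall>(k::real) (\<phi>::real^'n::finite \<Rightarrow> complex) \<xi> \<eta> A. 
        0 \<le> k \<longrightarrow> k * CARD('n) * H \<le> h \<longrightarrow> 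
        smooth \<phi> \<and> supp \<phi> \<subseteq> K \<and> DK_bound M h A \<phi> \<and> norm \<xi> \<le> R \<longrightarrow>
        exp (assoc_fun M (k * norm \<eta>)) * norm (lap \<phi> \<xi> \<eta>) \<le> C * A * wt \<eta>"
      using C0 L by (intro exI[of _ "C * L"]) (auto simp: mult_ac)
  qed
qed

text \<open>Unifies the two cases: Beurling prescribes \<open>k\<close> and lets \<open>h\<close> depend on it, Roumieu the other way round.\<close>
lemma growth_times_decay:
  fixes g :: "'b \<Rightarrow> real^'n::finite \<Rightarrow> complex" and L :: "'x \<Rightarrow> real^'n \<Rightarrow> complex" 
    and bd :: "real \<Rightarrow> real \<Rightarrow> 'x \<Rightarrow> bool"
  assumes H: "H \<ge> 1"
    and g: "if beurling then \<exists>C>0. \<exists>k>0. \<forall>\<xi>\<in>K. \<forall>\<eta>. norm (g \<xi> \<eta>) \<le> C * exp (assoc_fun M (k * norm \<eta>))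
       else \<forall>k>0. \<exists>C>0. \<forall>\<xi>\<in>K. \<forall>\<eta>. norm (g \<xi> \<eta>) \<le> C * exp (assoc_fun M (k * norm \<eta>))"
    and L: "\<And>h. h > 0 \<Longrightarrow> \<exists>C\<ge>0. \<forall>(k::real) X \<eta> A. 0 \<le> k \<longrightarrow> k * CARD('n) * H \<le> h \<longrightarrow> bd h A X \<longrightarrow>
        exp (assoc_fun M (k * norm \<eta>)) * norm (L X \<eta>) \<le> C * A * wt \<eta>"
  defines "Q \<equiv> \<lambda>h. \<exists>C\<ge>0. \<forall>X A. bd h A X \<longrightarrow> (\<forall>\<xi>\<in>K. \<forall>\<eta>. norm (g \<xi> \<eta> * L X \<eta>) \<le> C * A * wt \<eta>)"
  shows "if beurling then \<exists>h>0. Q h else \<forall>h>0. Q h"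
proof -
  have Q: "Q h" if h: "h > 0" and k: "0 \<le> k" "k * CARD('n) * H \<le> h" 
    and C: "C > 0" "\<And>\<xi> \<eta>. \<xi> \<in> K \<Longrightarrow> norm (g \<xi> \<eta>) \<le> C * exp (assoc_fun M (k * norm \<eta>))" for h k C :: real
  proof -
    from L[OF h] obtain D where D: "D \<ge> 0" "\<And>X \<eta> A. bd h A X \<Longrightarrow> 
        exp (assoc_fun M (k * norm \<eta>)) * norm (L X \<eta>) \<le> D * A * wt \<eta>" using k by blast
    have "norm (g \<xi> \<eta> * L X \<eta>) \<le> (C * D) * A * wt \<eta>" if X: "bd h A X" and \<xi>: "\<xi> \<in> K" for X A \<xi> \<eta>
    proof -
      have "norm (g \<xi> \<eta> * L X \<eta>) \<le> (C * exp (assoc_fun M (k * norm \<eta>))) * norm (L X \<eta>)"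
        unfolding norm_mult by (intro mult_right_mono C(2) \<xi>) auto
      also have "\<dots> = C * (exp (assoc_fun M (k * norm \<eta>)) * norm (L X \<eta>))" by simp
      also have "\<dots> \<le> C * (D * A * wt \<eta>)" using C(1) by (intro mult_left_mono D(2) X) auto
      finally show ?thesis by (simp add: mult_ac)
    qed
    then show "Q h" using C(1) D(1) unfolding Q_def by (intro exI[of _ "C * D"]) auto
  qed
  show ?thesis
  proof (cases beurling)
    case True
    with g obtain C k where "C > 0" "k > 0" "\<And>\<xi> \<eta>. \<xi> \<in> K \<Longrightarrow> norm (g \<xi> \<eta>) \<le> C * exp (assoc_fun M (k * norm \<eta>))"
      by (auto split: if_splits)
    \<comment> \<open>In the Beurling case \<open>k\<close> is given and this is the smallest h
      allowed by the decay estimate; in the Roumieu case below, \<open>k\<close> is the largest one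
      allowed by the given h.\<close>
    then have "Q (k * CARD('n) * H)" using H by (intro Q[of _ k C]) auto
    moreover have "k * CARD('n) * H > 0" using \<open>k > 0\<close> H by simp
    ultimately show ?thesis using True by auto
  next
    case False
    have "Q h" if h: "h > 0" for h
    proof -
      define k where "k = h / (CARD('n) * H)"
      have k: "k > 0" "k * CARD('n) * H = h" using h H by (auto simp: k_def)
      with g False obtain C where "C > 0" "\<And>\<xi> \<eta>. \<xi> \<in> K \<Longrightarrow> norm (g \<xi> \<eta>) \<le> C * exp (assoc_fun M (k * norm \<eta>))"
        by (auto split: if_splits)
      then show ?thesis using h k by (intro Q[of _ k C]) auto
    qed
    then show ?thesis using False by simp
  qed
qed

section \<open>Continuity and holomorphy on the tube\<close>

lemma lap_eq_integral_cbox: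
  fixes \<phi> :: "real^'n::finite \<Rightarrow> complex"
  assumes c: "continuous_on UNIV \<phi>" and s: "supp \<phi> \<subseteq> cbox a b"
  shows "lap \<phi> \<xi> \<eta> = integral (cbox a b) (\<lambda>x. exp (of_real (x \<bullet> \<xi>) + \<i> * of_real (x \<bullet> \<eta>)) * \<phi> x)"
proof -
  let ?F = "\<lambda>x. exp (complex_of_real (x \<bullet> \<xi>) + \<i> * of_real (x \<bullet> \<eta>)) * \<phi> x"
  have z: "\<phi> x = 0" if "x \<notin> cbox a b" for x
    using that s closure_subset[of "{x. \<phi> x \<noteq> 0}"] by (auto simp: supp_def)
  have "continuous_on (cbox a b) ?F"
    by (intro continuous_intros continuous_on_subset[OF c]) auto
  then have i: "set_integrable lborel (cbox a b) ?F"
    unfolding set_integrable_def by (intro borel_integrable_compact) auto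
  have "lap \<phi> \<xi> \<eta> = (LINT x:cbox a b|lborel. ?F x)"
    unfolding lap_def set_lebesgue_integral_def
  proof (rule Bochner_Integration.integral_cong[OF refl])
    fix x show "?F x = indicat_real (cbox a b) x *\<^sub>R ?F x" using z[of x] by (cases "x \<in> cbox a b") auto
  qed
  then show ?thesis using set_borel_integral_eq_integral(2)[OF i] by simp
qed

lemma compact_supp_cbox:
  fixes \<phi> :: "real^'n::finite \<Rightarrow> complex"
  assumes "compact (supp \<phi>)"
  obtains a b where "supp \<phi> \<subseteq> cbox a b"
  using bounded_subset_cbox_symmetric[OF compact_imp_bounded[OF assms]] by blast

text \<open>Compact support allows the transform to be written as an integral over a fixed box,
  where joint continuity of the integrand suffices for continuity in the parameters.\<close>

lemma continuous_on_lap: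
  fixes \<phi> :: "real^'n::finite \<Rightarrow> complex"
  assumes c: "continuous_on UNIV \<phi>" and s: "compact (supp \<phi>)"
  shows "continuous_on UNIV (\<lambda>p. lap \<phi> (fst p) (snd p))"
proof -
  from compact_supp_cbox[OF s] obtain a b where ab: "supp \<phi> \<subseteq> cbox a b" .
  have "continuous_on (UNIV \<times> cbox a b) (\<lambda>(p, x). exp (complex_of_real (x \<bullet> fst p) + \<i> * of_real (x \<bullet> snd p)) * \<phi> x)"
    unfolding case_prod_beta
    by (intro continuous_intros continuous_on_compose2[OF c]) auto
  from integral_continuous_on_param[OF this] show ?thesis
    unfolding lap_eq_integral_cbox[OF c ab] .
qed

text \<open>Along a complex line the exponent is affine in u, so the integrand is entire in u, and
  the Leibniz rule applies on a fixed box.\<close>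

lemma lap_slice_holomorphic:
  fixes \<phi> :: "real^'n::finite \<Rightarrow> complex"
  assumes c: "continuous_on UNIV \<phi>" and s: "compact (supp \<phi>)"
  shows "(\<lambda>u. lap \<phi> (\<xi> + Re u *\<^sub>R e) (\<eta> + Im u *\<^sub>R e)) holomorphic_on A"
proof -
  from compact_supp_cbox[OF s] obtain a b where ab: "supp \<phi> \<subseteq> cbox a b" .
  define F where "F u x = exp (complex_of_real (x \<bullet> \<xi>) + \<i> * of_real (x \<bullet> \<eta>) + u * of_real (x \<bullet> e)) * \<phi> x" for u x
  have cF: "continuous_on (UNIV \<times> cbox a b) (\<lambda>(u, x). of_real (x \<bullet> e) * F u x)"
    unfolding case_prod_beta F_def
    by (intro continuous_intros continuous_on_compose2[OF c]) auto
  have "(\<lambda>u. integral (cbox a b) (F u)) holomorphic_on UNIV"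
  proof (rule leibniz_rule_holomorphic)
    show "((\<lambda>u. F u x) has_field_derivative of_real (x \<bullet> e) * F u x) (at u within UNIV)" for u x
      unfolding F_def by (auto intro!: derivative_eq_intros)
    show "F u integrable_on cbox a b" for u
      unfolding F_def by (intro integrable_continuous continuous_intros continuous_on_compose2[OF c]) auto
  qed (use cF in auto)
  moreover have "lap \<phi> (\<xi> + Re u *\<^sub>R e) (\<eta> + Im u *\<^sub>R e) = integral (cbox a b) (F u)" for u
  proof -
    have "of_real (x \<bullet> (\<xi> + Re u *\<^sub>R e)) + \<i> * of_real (x \<bullet> (\<eta> + Im u *\<^sub>R e)) = 
      complex_of_real (x \<bullet> \<xi>) + \<i> * of_real (x \<bullet> \<eta>) + u * of_real (x \<bullet> e)" for x
      by (simp add: complex_eq_iff inner_add_right)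
    then show ?thesis unfolding lap_eq_integral_cbox[OF c ab] F_def by simp
  qed
  ultimately show ?thesis using holomorphic_on_subset by fastforce
qed

lemma tube_pt_line: "tube_pt (\<xi> + Re u *\<^sub>R e) (\<eta> + Im u *\<^sub>R e) = tube_pt \<xi> \<eta> + u *s (\<chi> j. complex_of_real (e $ j))"
  by (simp add: tube_pt_def vec_eq_iff complex_eq_iff)

lemma continuous_on_tube_pt: "continuous_on A (\<lambda>p. tube_pt (fst p) (snd p))"
  unfolding tube_pt_def Complex_eq
  by (intro continuous_on_vec_lambda continuous_intros)

text \<open>The real direction \<open>e\<close>, read as a complex vector c, spans a complex line.
  Complex homogeneity of the Frechet derivative \<open>L\<close> makes the derivative along this
  line multiplication by \<open>L c\<close>.\<close>

lemma holomorphic_on_n_slice: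
  fixes f :: "complex^'n::finite \<Rightarrow> complex"
  assumes "holomorphic_on_n f {tube_pt \<xi> \<eta> | \<xi> \<eta>. \<xi> \<in> B}"
  shows "(\<lambda>u. f (tube_pt (\<xi> + Re u *\<^sub>R e) (\<eta> + Im u *\<^sub>R e))) holomorphic_on {u. \<xi> + Re u *\<^sub>R e \<in> B}"
proof (rule holomorphic_onI)
  fix u assume u: "u \<in> {u. \<xi> + Re u *\<^sub>R e \<in> B}"
  define c where "c = (\<chi> j. complex_of_real (e $ j))"
  define z where "z = tube_pt \<xi> \<eta>"
  have "z + u *s c \<in> {tube_pt \<xi> \<eta> | \<xi> \<eta>. \<xi> \<in> B}"
    using u unfolding z_def c_def tube_pt_line[symmetric] by auto
  then obtain L where L: "(f has_derivative L) (at (z + u *s c))" "\<And>a v. L (a *s v) = a * L v"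
    using assms unfolding holomorphic_on_n_def by blast
  have "bounded_linear (\<lambda>u. u *s c)"
  proof (rule bounded_linearI')
    show "(x + y) *s c = x *s c + y *s c" for x y :: complex by (simp add: vec_eq_iff algebra_simps)
    show "(r *\<^sub>R x) *s c = r *\<^sub>R (x *s c)" for r and x :: complex by (simp add: vec_eq_iff)
  qed
  then have "((\<lambda>u. z + u *s c) has_derivative (\<lambda>h. h *s c)) (at u)"
    by (auto intro!: derivative_eq_intros bounded_linear_imp_has_derivative)
  from has_derivative_compose[OF this L(1)]
  have "((\<lambda>u. f (z + u *s c)) has_derivative (\<lambda>h. L c * h)) (at u)"
    by (simp add: L(2) mult.commute)
  then have "((\<lambda>u. f (z + u *s c)) has_field_derivative L c) (at u)"
    by (simp add: has_field_derivative_def)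
  then show "(\<lambda>u. f (tube_pt (\<xi> + Re u *\<^sub>R e) (\<eta> + Im u *\<^sub>R e))) field_differentiable at u within {u. \<xi> + Re u *\<^sub>R e \<in> B}"
    unfolding tube_pt_line z_def[symmetric] c_def[symmetric]
    using field_differentiable_at_within field_differentiable_def by blast
qed

lemma holomorphic_on_n_tube_continuous:
  fixes f :: "complex^'n::finite \<Rightarrow> complex"
  assumes "holomorphic_on_n f {tube_pt \<xi> \<eta> | \<xi> \<eta>. \<xi> \<in> B}"
  shows "continuous_on (B \<times> UNIV) (\<lambda>p. f (tube_pt (fst p) (snd p)))"
proof (rule continuous_on_compose2[OF _ continuous_on_tube_pt])
  show "continuous_on {tube_pt \<xi> \<eta> | \<xi> \<eta>. \<xi> \<in> B} f"
    using assms unfolding holomorphic_on_n_def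
    by (intro continuous_at_imp_continuous_on) (blast intro: has_derivative_continuous)
qed auto

section \<open>The pairing of \<open>f\<close> with the transform and its independence of the real
  part\<close>

lemma wt_le_1: "wt x \<le> 1"
  unfolding wt_def by (intro prod_le_1) (simp add: divide_le_eq_1 add_pos_nonneg)

lemma wt_minus: "wt (- x) = wt x"
  by (simp add: wt_def)

text \<open>Holds for every \<open>F\<close>: a Bochner integral that does not exist has the value
  0, and then the claim reduces to \<open>D \<ge> 0\<close>, which the bound at one point
  provides.\<close>

lemma norm_integral_le_wt:
  fixes F :: "'a::euclidean_space \<Rightarrow> complex"
  assumes "\<And>x. norm (F x) \<le> D * wt x"
  shows "norm (integral\<^sup>L lborel F) \<le> D * integral\<^sup>L lborel (wt :: 'a \<Rightarrow> real)"
proof (cases "integrable lborel F")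
  case True
  have "norm (integral\<^sup>L lborel F) \<le> integral\<^sup>L lborel (\<lambda>x. norm (F x))" by (rule integral_norm_bound)
  also have "\<dots> \<le> integral\<^sup>L lborel (\<lambda>x::'a. D * wt x)"
    by (rule integral_mono) (use True assms integrable_wt in auto)
  also have "\<dots> = D * integral\<^sup>L lborel (wt :: 'a \<Rightarrow> real)" by (rule integral_mult_right_zero)
  finally show ?thesis .
next
  case False
  have "0 \<le> D * wt (0::'a)" using assms[of 0] norm_ge_zero order_trans by blast
  then have "D \<ge> 0" using wt_pos[of "0::'a"] by (simp add: zero_le_mult_iff)
  moreover have "integral\<^sup>L lborel (wt :: 'a \<Rightarrow> real) \<ge> 0"
    by (intro integral_nonneg_AE) (simp add: less_imp_le[OF wt_pos])
  ultimately show ?thesis using False by (simp add: not_integrable_integral_eq)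
qed

lemma integrable_le_wt:
  fixes F :: "'a::euclidean_space \<Rightarrow> complex"
  assumes "F \<in> borel_measurable borel" "\<And>x. norm (F x) \<le> D * wt x"
  shows "integrable lborel F"
proof (rule Bochner_Integration.integrable_bound)
  show "integrable lborel (\<lambda>x::'a. D * wt x)" by (intro integrable_mult_right integrable_wt)
  show "AE x in lborel. norm (F x) \<le> norm (D * wt x)"
    using order_trans[OF assms(2) abs_ge_self] by simp
qed (use assms(1) in simp)

lemma measurable_lap:
  fixes \<phi> :: "real^'n::finite \<Rightarrow> complex"
  assumes "continuous_on UNIV \<phi>"
  shows "lap \<phi> \<xi> \<in> borel_measurable borel"
proof -
  have [measurable]: "\<phi> \<in> borel_measurable borel" by (rule borel_measurable_continuous_onI[OF assms])
  have "(\<lambda>\<eta>. lap \<phi> \<xi> \<eta>) \<in> borel_measurable borel"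
    unfolding lap_def by (rule lborel.borel_measurable_lebesgue_integral) measurable
  then show ?thesis by simp
qed

lemma lap_linear:
  fixes \<phi> \<psi> :: "real^'n::finite \<Rightarrow> complex"
  assumes "continuous_on UNIV \<phi>" "integrable lborel (\<lambda>x. exp (x \<bullet> \<xi>) * norm (\<phi> x))"
    and "continuous_on UNIV \<psi>" "integrable lborel (\<lambda>x. exp (x \<bullet> \<xi>) * norm (\<psi> x))"
  shows "lap (\<lambda>x. a * \<phi> x + b * \<psi> x) \<xi> \<eta> = a * lap \<phi> \<xi> \<eta> + b * lap \<psi> \<xi> \<eta>"
proof -
  define E where "E x = exp (complex_of_real (x \<bullet> \<xi>) + \<i> * of_real (x \<bullet> \<eta>))" for x
  have i: "integrable lborel (\<lambda>x. E x * \<phi> x)" "integrable lborel (\<lambda>x. E x * \<psi> x)"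
    unfolding E_def by (intro integrable_lap assms)+
  have "lap (\<lambda>x. a * \<phi> x + b * \<psi> x) \<xi> \<eta> = integral\<^sup>L lborel (\<lambda>x. a * (E x * \<phi> x) + b * (E x * \<psi> x))"
    unfolding lap_def E_def[symmetric] by (simp add: algebra_simps)
  also have "\<dots> = a * integral\<^sup>L lborel (\<lambda>x. E x * \<phi> x) + b * integral\<^sup>L lborel (\<lambda>x. E x * \<psi> x)"
    using i by simp
  finally show ?thesis by (simp only: lap_def E_def)
qed

text \<open>The function space enters only through continuity and integrability, so one lemma serves
  \<open>test_space\<close> at the base point and \<open>S_space\<close> at \<xi> = 0.\<close>

lemma lin_on_pairing:
  fixes g :: "real^'n::finite \<Rightarrow> complex"
  assumes V: "\<And>\<phi>. \<phi> \<in> V \<Longrightarrow> continuous_on UNIV \<phi>" "\<And>\<phi>. \<phi> \<in> V \<Longrightarrow> integrable lborel (\<lambda>x. exp (x \<bullet> \<xi>) * norm (\<phi> x))"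
    "\<And>\<phi>. \<phi> \<in> V \<Longrightarrow> integrable lborel (\<lambda>\<eta>. g \<eta> * lap \<phi> \<xi> \<eta>)"
  shows "lin_on V (\<lambda>\<phi>. c * integral\<^sup>L lborel (\<lambda>\<eta>. g \<eta> * lap \<phi> \<xi> \<eta>))"
  unfolding lin_on_def
proof (intro ballI allI)
  fix \<phi> \<psi> a b assume *: "\<phi> \<in> V" "\<psi> \<in> V"
  have "integral\<^sup>L lborel (\<lambda>\<eta>. g \<eta> * lap (\<lambda>x. a * \<phi> x + b * \<psi> x) \<xi> \<eta>)
    = integral\<^sup>L lborel (\<lambda>\<eta>. a * (g \<eta> * lap \<phi> \<xi> \<eta>) + b * (g \<eta> * lap \<psi> \<xi> \<eta>))"
    by (subst lap_linear) (use * V in \<open>auto simp: algebra_simps\<close>)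
  also have "\<dots> = a * integral\<^sup>L lborel (\<lambda>\<eta>. g \<eta> * lap \<phi> \<xi> \<eta>) + b * integral\<^sup>L lborel (\<lambda>\<eta>. g \<eta> * lap \<psi> \<xi> \<eta>)"
    using V(3)[OF *(1)] V(3)[OF *(2)] by simp
  finally show "c * integral\<^sup>L lborel (\<lambda>\<eta>. g \<eta> * lap (\<lambda>x. a * \<phi> x + b * \<psi> x) \<xi> \<eta>)
     = a * (c * integral\<^sup>L lborel (\<lambda>\<eta>. g \<eta> * lap \<phi> \<xi> \<eta>)) + b * (c * integral\<^sup>L lborel (\<lambda>\<eta>. g \<eta> * lap \<psi> \<xi> \<eta>))"
    by (simp add: algebra_simps)
qed

text \<open>The arguments of \<open>f\<close> and \<open>lap \<phi>\<close> move in parallel, so on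
  each complex line the integrand is holomorphic. On a ball inside \<open>B\<close> the contour
  shift shows that the integral is constant. The offset \<open>\<xi>1\<close> accounts for
  multiplication of the test function by e^(-x\<xi>1).\<close>

lemma integral_tube_independent:
  fixes f :: "complex^'n::finite \<Rightarrow> complex" and \<phi> :: "real^'n \<Rightarrow> complex"
  assumes B: "open B" "connected B" and f: "holomorphic_on_n f {tube_pt \<xi> \<eta> | \<xi> \<eta>. \<xi> \<in> B}"
    and \<phi>: "continuous_on UNIV \<phi>" "compact (supp \<phi>)"
    and bd: "\<And>K R. compact K \<Longrightarrow> K \<subseteq> B \<Longrightarrow> R \<ge> 0 \<Longrightarrow> 
       \<exists>C. \<forall>\<xi>\<in>K. \<forall>\<xi>' \<eta>. norm \<xi>' \<le> R \<longrightarrow> norm (f (tube_pt \<xi> \<eta>) * lap \<phi> \<xi>' \<eta>) \<le> C * wt \<eta>"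
    and x: "\<xi>0 \<in> B" "\<xi> \<in> B"
  shows "integral\<^sup>L lborel (\<lambda>\<eta>. f (tube_pt \<xi>0 \<eta>) * lap \<phi> (\<xi>0 - \<xi>1) \<eta>)
       = integral\<^sup>L lborel (\<lambda>\<eta>. f (tube_pt \<xi> \<eta>) * lap \<phi> (\<xi> - \<xi>1) \<eta>)"
proof (rule connected_local_const[OF B(2) x], intro ballI)
  fix a assume a: "a \<in> B"
  define G where "G \<xi> \<eta> = f (tube_pt \<xi> \<eta>) * lap \<phi> (\<xi> - \<xi>1) \<eta>" for \<xi> \<eta>
  from open_contains_cball[of B] B(1) a obtain r where r: "r > 0" "cball a r \<subseteq> B" by blast
  then have rB: "ball a r \<subseteq> B" using ball_subset_cball by blast
  \<comment> \<open>Bounds the offset argument \<xi> - \<open>\<xi>1\<close> of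
    \<open>lap \<phi>\<close> for every \<xi> in the ball, so that one constant serves the whole
    neighbourhood of a.\<close>
  define R where "R = norm a + r + norm \<xi>1"
  have "\<exists>C. \<forall>\<xi>\<in>cball a r. \<forall>\<xi>' \<eta>. norm \<xi>' \<le> R \<longrightarrow> norm (f (tube_pt \<xi> \<eta>) * lap \<phi> \<xi>' \<eta>) \<le> C * wt \<eta>"
    by (rule bd) (use r in \<open>auto simp: R_def\<close>)
  then obtain C where C: "\<And>\<xi> \<xi>' \<eta>. \<xi> \<in> cball a r \<Longrightarrow> norm \<xi>' \<le> R \<Longrightarrow> norm (f (tube_pt \<xi> \<eta>) * lap \<phi> \<xi>' \<eta>) \<le> C * wt \<eta>"
    by blast
  have G: "norm (G \<xi> \<eta>) \<le> C * wt \<eta>" if "\<xi> \<in> ball a r" for \<xi> \<eta>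
    unfolding G_def
  proof (rule C)
    have "norm (\<xi> - \<xi>1) \<le> norm \<xi> + norm \<xi>1" by (rule norm_triangle_ineq4)
    moreover have "norm \<xi> \<le> norm a + r"
      using that norm_triangle_sub[of \<xi> a] by (simp add: dist_norm norm_minus_commute)
    ultimately show "norm (\<xi> - \<xi>1) \<le> R" by (simp add: R_def)
  qed (use that in simp)
  have main: "integral\<^sup>L lborel (G a) = integral\<^sup>L lborel (G b)" if b: "b \<in> ball a r" for b
  proof -
    define e where "e = b - a"
    have b_eq: "b = a + e" by (simp add: e_def)
    have seg: "a + t *\<^sub>R e \<in> ball a r" if "t \<in> {0..1}" for t
    proof -
      have "dist a (a + t *\<^sub>R e) = \<bar>t\<bar> * norm e" by (simp add: dist_norm)
      also have "\<dots> \<le> norm e" using that by (simp add: mult_left_le_one_le)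
      also have "\<dots> < r" using b by (simp add: e_def dist_norm norm_minus_commute)
      finally show ?thesis by simp
    qed
    have "integral\<^sup>L lborel (G (a + e)) = integral\<^sup>L lborel (G a)"
    proof (rule integral_contour_shift[where B="ball a r" and F="\<lambda>\<eta>. C * wt \<eta>"])
      show "(\<lambda>u. G (a + Re u *\<^sub>R e) (\<eta> + Im u *\<^sub>R e)) holomorphic_on {u. a + Re u *\<^sub>R e \<in> ball a r}" for \<eta>
      proof -
        have "(\<lambda>u. f (tube_pt (a + Re u *\<^sub>R e) (\<eta> + Im u *\<^sub>R e))) holomorphic_on {u. a + Re u *\<^sub>R e \<in> ball a r}"
          by (rule holomorphic_on_subset[OF holomorphic_on_n_slice[OF f]]) (use rB in auto)
        moreover have "(\<lambda>u. lap \<phi> ((a - \<xi>1) + Re u *\<^sub>R e) (\<eta> + Im u *\<^sub>R e)) holomorphic_on {u. a + Re u *\<^sub>R e \<in> ball a r}"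
          by (rule lap_slice_holomorphic[OF \<phi>])
        moreover have "(a - \<xi>1) + y = a + y - \<xi>1" for y by simp
        ultimately show ?thesis unfolding G_def by (intro holomorphic_on_mult) simp_all
      qed
      have "continuous_on (ball a r \<times> UNIV) (\<lambda>p. f (tube_pt (fst p) (snd p)))"
        by (rule continuous_on_subset[OF holomorphic_on_n_tube_continuous[OF f]]) (use rB in auto)
      moreover have "continuous_on (ball a r \<times> UNIV) (\<lambda>p. (\<lambda>p. lap \<phi> (fst p) (snd p)) (fst p - \<xi>1, snd p))"
        by (rule continuous_on_compose2[OF continuous_on_lap[OF \<phi>]]) (auto intro!: continuous_intros)
      ultimately show "continuous_on (ball a r \<times> UNIV) (\<lambda>(\<xi>, \<eta>). G \<xi> \<eta>)"
        unfolding G_def case_prod_beta by (intro continuous_intros) simp_all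
    qed (use r seg seg[of 1] G in \<open>auto intro!: integrable_mult_right integrable_wt\<close>)
    then show ?thesis unfolding b_eq ..
  qed
  have "eventually (\<lambda>b. b \<in> ball a r) (at a within B)"
    using eventually_at_ball[OF r(1)] by (rule eventually_mono) simp
  then show "\<forall>\<^sub>F b in at a within B. (\<integral>\<eta>. f (tube_pt a \<eta>) * lap \<phi> (a - \<xi>1) \<eta> \<partial>lborel)
      = (\<integral>\<eta>. f (tube_pt b \<eta>) * lap \<phi> (b - \<xi>1) \<eta> \<partial>lborel)"
    by eventually_elim (use main in \<open>simp add: G_def[abs_def]\<close>)
qed

section \<open>The ultradistribution and its Fourier-Laplace transform\<close>

lemma test_spaceD:
  assumes "\<phi> \<in> test_space beurling M"
  shows "smooth \<phi>" "compact (supp \<phi>)"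
    "if beurling then \<forall>h>0. \<exists>A. DK_bound M h A \<phi> else \<exists>h>0. \<exists>A. DK_bound M h A \<phi>"
    "\<exists>h>0. \<exists>A. DK_bound M h A \<phi>"
  using assms gt_ex[of "0::real"] unfolding test_space_def by (auto split: if_splits)

lemma S_spaceD:
  assumes "\<phi> \<in> S_space beurling M"
  shows "smooth \<phi>"
    "if beurling then \<forall>m>0. \<exists>A. sigma_bound M m A \<phi> else \<exists>m>0. \<exists>A. sigma_bound M m A \<phi>"
    "\<exists>m>0. \<exists>A. sigma_bound M m A \<phi>"
  using assms gt_ex[of "0::real"] unfolding S_space_def by (auto split: if_splits)

text \<open>The estimate and the membership have opposite quantifiers: one holds for some parameter
  and the other for all, in either type. Hence a parameter good for both exists.\<close>

lemma common_parameter: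
  assumes "if beurling then \<exists>h>0::real. Q h else \<forall>h>0. Q h"
    and "if beurling then \<forall>h>0. \<exists>A::real. D h A else \<exists>h>0. \<exists>A. D h A"
  obtains h A where "h > 0" "Q h" "D h A"
  using assms by (cases beurling) auto

lemma integrable_exp_test:
  assumes "weight_seq M" "\<phi> \<in> test_space beurling M"
  shows "integrable lborel (\<lambda>x. exp (x \<bullet> \<xi>) * norm (\<phi> x))"
proof -
  note t = test_spaceD[OF assms(2)]
  obtain h A where h: "h > 0" "DK_bound M h A \<phi>" using t(4) by blast
  obtain r where r: "\<And>x. x \<in> supp \<phi> \<Longrightarrow> norm x \<le> r"
    using compact_imp_bounded[OF t(2)] unfolding bounded_iff by blast
  have "integrable lborel (\<lambda>x. exp (x \<bullet> \<xi>) * norm (Dmi (\<lambda>_. 0) \<phi> x))"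
    by (rule DK_bound_integral(1)[OF h t(1,2) order_refl r order_refl norm_ge_zero])
  then show ?thesis by (simp only: Dmi_0[OF t(1)])
qed

lemma integrable_S_space:
  assumes "\<phi> \<in> S_space beurling M"
  shows "integrable lborel \<phi>" "integrable lborel (\<lambda>x. norm (\<phi> x))"
proof -
  note t = S_spaceD[OF assms]
  obtain m A where m: "m > 0" "sigma_bound M m A \<phi>" using t(3) by blast
  from sigma_bound_integral(1)[OF m t(1), of "\<lambda>_. 0"] show "integrable lborel (\<lambda>x. norm (\<phi> x))"
    by (simp only: Dmi_0[OF t(1)])
  then show "integrable lborel \<phi>"
    by (subst (asm) integrable_norm_iff)
      (simp_all add: borel_measurable_continuous_onI[OF smooth_imp_continuous[OF t(1)]])
qed

lemma bounded_S_space: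
  fixes \<phi> :: "real^'n::finite \<Rightarrow> complex"
  assumes M: "weight_seq M" and "\<phi> \<in> S_space beurling M"
  obtains C where "\<And>x. norm (\<phi> x) \<le> C"
proof -
  note t = S_spaceD[OF assms(2)]
  obtain m A where m: "m > 0" "sigma_bound M m A \<phi>" using t(3) by blast
  let ?B = "A * (M (2 * CARD('n)) / m ^ (2 * CARD('n)))"
  have b: "norm (\<phi> x) \<le> ?B * wt x" for x
    using sigma_bound_pointwise[OF m, of "\<lambda>_. 0" x] weight_seq_0[OF M]
    by (simp add: Dmi_0[OF t(1)] mi_len_def)
  have "0 \<le> ?B * wt (0::real^'n)" using b[of 0] norm_ge_zero order_trans by blast
  then have "?B \<ge> 0" using wt_pos[of "0::real^'n"] by (simp only: zero_le_mult_iff) auto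
  then have "norm (\<phi> x) \<le> ?B" for x
    using order_trans[OF b[of x] mult_left_mono[OF wt_le_1]] by simp
  then show ?thesis by (rule that)
qed

lemma fourier_eq_lap: "fourier \<psi> x = lap \<psi> 0 (- x)"
  by (simp add: fourier_def lap_def)

lemma integrable_fourier_S_space:
  fixes \<psi> :: "real^'n::finite \<Rightarrow> complex"
  assumes M: "weight_seq M" and \<psi>: "\<psi> \<in> S_space beurling M"
  shows "integrable lborel (fourier \<psi>)"
proof (rule lap_decay_sigma[OF M, where 'n='n])
  fix H :: real assume H: "H \<ge> 1" and dec: "\<And>m. m > 0 \<Longrightarrow> \<exists>C\<ge>0. \<forall>(k::real) (\<phi>::real^'n::finite \<Rightarrow> complex) \<eta> A. 
        0 \<le> k \<longrightarrow> k * CARD('n) * H \<le> m \<longrightarrow> smooth \<phi> \<and> sigma_bound M m A \<phi> \<longrightarrow>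
        exp (assoc_fun M (k * norm \<eta>)) * norm (lap \<phi> 0 \<eta>) \<le> C * A * wt \<eta>"
  note t = S_spaceD[OF \<psi>]
  obtain m A where m: "m > 0" "sigma_bound M m A \<psi>" using t(3) by blast
  obtain C where C: "\<forall>(k::real) (\<phi>::real^'n::finite \<Rightarrow> complex) \<eta> A. 
        0 \<le> k \<longrightarrow> k * CARD('n) * H \<le> m \<longrightarrow> smooth \<phi> \<and> sigma_bound M m A \<phi> \<longrightarrow>
        exp (assoc_fun M (k * norm \<eta>)) * norm (lap \<phi> 0 \<eta>) \<le> C * A * wt \<eta>"
    using dec[OF m(1)] by blast
  \<comment> \<open>The decay estimate is taken at k = 0, where the exponential factor is 1 and the
    integrable weight alone remains.\<close>
  have b: "norm (lap \<psi> 0 \<eta>) \<le> C * A * wt \<eta>" for \<eta>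
    using C[rule_format, of 0 \<psi> A \<eta>] m t(1) assoc_fun_0[of M] weight_seq_0[OF M] by simp
  have e: "fourier \<psi> = (\<lambda>x. lap \<psi> 0 (- x))" by (rule ext) (rule fourier_eq_lap)
  note [measurable] = measurable_lap[OF smooth_imp_continuous[OF t(1)], of 0]
  show "integrable lborel (fourier \<psi>)"
  proof (rule integrable_le_wt)
    show "fourier \<psi> \<in> borel_measurable borel" unfolding e by measurable
    show "norm (fourier \<psi> x) \<le> C * A * wt x" for x
      using b[of "- x"] by (simp add: e wt_minus)
  qed
qed

text \<open>At real part 0 the kernel of \<open>lap\<close> is that of the inverse transform without
  its normalising constant.\<close>

lemma lap_fourier:
  fixes \<psi> :: "real^'n::finite \<Rightarrow> complex"
  assumes M: "weight_seq M" and \<psi>: "\<psi> \<in> S_space beurling M"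
  shows "lap (fourier \<psi>) 0 \<eta> = of_real ((2 * pi) ^ CARD('n)) * \<psi> \<eta>"
proof -
  obtain C where C: "\<And>x. norm (\<psi> x) \<le> C" using bounded_S_space[OF M \<psi>] by blast
  have F: "fourier \<psi> = (\<lambda>x. integral\<^sup>L lborel (\<lambda>\<eta>. exp (- (\<i> * of_real (\<eta> \<bullet> x))) * \<psi> \<eta>))"
    by (rule ext) (rule fourier_def)
  have "integrable lborel (\<lambda>x. integral\<^sup>L lborel (\<lambda>\<eta>. exp (- (\<i> * of_real (\<eta> \<bullet> x))) * \<psi> \<eta>))"
    using integrable_fourier_S_space[OF M \<psi>] unfolding F .
  from fourier_inversion[OF integrable_S_space(1)[OF \<psi>] smooth_imp_continuous[OF S_spaceD(1)[OF \<psi>]] C this, of \<eta>]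
  show ?thesis unfolding lap_def F by simp
qed

theorem theorem2:
  fixes M :: "nat \<Rightarrow> real" and beurling :: bool
    and B :: "(real^'n::finite) set" and f :: "complex^'n \<Rightarrow> complex"
  assumes "weight_seq M"
    and "open B" and "connected B"
    and "holomorphic_on_n f {tube_pt \<xi> \<eta> | \<xi> \<eta>. \<xi> \<in> B}"
    and "\<forall>K. compact K \<and> K \<subseteq> B \<longrightarrow>
           (if beurling then
              (\<exists>C>0. \<exists>k>0. \<forall>\<xi>\<in>K. \<forall>\<eta>.
                  norm (f (tube_pt \<xi> \<eta>)) \<le> C * exp (assoc_fun M (k * norm \<eta>)))
            else
              (\<forall>k>0. \<exists>C>0. \<forall>\<xi>\<in>K. \<forall>\<eta>.
                  norm (f (tube_pt \<xi> \<eta>)) \<le> C * exp (assoc_fun M (k * norm \<eta>))))"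
  shows "\<exists>S. ultradistribution beurling M S \<and>
           (\<forall>\<xi>\<in>B. \<exists>T. tempered_ultradistribution beurling M T \<and>
              (\<forall>\<phi>\<in>test_space beurling M.
                  T \<phi> = S (\<lambda>x. complex_of_real (exp (- (x \<bullet> \<xi>))) * \<phi> x)) \<and>
              (\<forall>\<psi>\<in>S_space beurling M.
                  T (fourier \<psi>) = integral\<^sup>L lborel (\<lambda>\<eta>. f (tube_pt \<xi> \<eta>) * \<psi> \<eta>)))"
proof (cases "B = {}")
  \<comment> \<open>Without a point of \<open>B\<close> there is no base point for the integral; the
    zero functional serves, and the claim about all \<xi> in \<open>B\<close> is vacuous.\<close>
  case True
  have z: "\<exists>C. \<forall>\<phi>\<in>test_space beurling M. supp \<phi> \<subseteq> K \<longrightarrow> (\<forall>A. DK_bound M h A \<phi> \<longrightarrow> norm (0::complex) \<le> C * A)"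
    for K :: "(real^'n) set" and h by (rule exI[of _ 0]) simp
  have "ultradistribution beurling M (\<lambda>_::real^'n \<Rightarrow> complex. 0)"
    unfolding ultradistribution_def lin_on_def
    by (cases beurling) (use z zero_less_one[where 'a=real] in \<open>simp_all only: if_True if_False, simp_all, blast+\<close>)
  then show ?thesis using True by blast
next
  case False
  note M = assms(1) and f = assms(4)
  have growth: "if beurling then \<exists>C>0. \<exists>k>0. \<forall>\<xi>\<in>K. \<forall>\<eta>. norm (f (tube_pt \<xi> \<eta>)) \<le> C * exp (assoc_fun M (k * norm \<eta>))
      else \<forall>k>0. \<exists>C>0. \<forall>\<xi>\<in>K. \<forall>\<eta>. norm (f (tube_pt \<xi> \<eta>)) \<le> C * exp (assoc_fun M (k * norm \<eta>))"
    if "compact K" "K \<subseteq> B" for K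
    using assms(5) that by blast
  define w where "w = integral\<^sup>L lborel (wt :: real^'n \<Rightarrow> real)"
  define c :: complex where "c = of_real (1 / (2 * pi) ^ CARD('n))"
  \<comment> \<open>One pairing with independent real parts for \<open>f\<close> and
    \<open>\<phi>\<close>: \<open>S\<close> is \<open>I \<xi>0 \<xi>0\<close>, \<open>T\<close> is
    \<open>I \<xi> 0\<close>, and the contour shift relates \<open>I \<xi>0 (\<xi>0 - \<xi>)\<close>
    to \<open>I \<xi> 0\<close>.\<close>
  define I where "I \<xi> \<xi>' \<phi> = c * integral\<^sup>L lborel (\<lambda>\<eta>. f (tube_pt \<xi> \<eta>) * lap \<phi> \<xi>' \<eta>)" for \<xi> \<xi>' and \<phi> :: "real^'n \<Rightarrow> complex"
  have I_le: "norm (I \<xi> \<xi>' \<phi>) \<le> (norm c * C * w) * A"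
    if "\<And>\<eta>. norm (f (tube_pt \<xi> \<eta>) * lap \<phi> \<xi>' \<eta>) \<le> C * A * wt \<eta>" for \<xi> \<xi>' \<phi> C A
  proof -
    have "norm (integral\<^sup>L lborel (\<lambda>\<eta>. f (tube_pt \<xi> \<eta>) * lap \<phi> \<xi>' \<eta>)) \<le> C * A * w"
      unfolding w_def by (rule norm_integral_le_wt[OF that])
    then have "norm c * norm (integral\<^sup>L lborel (\<lambda>\<eta>. f (tube_pt \<xi> \<eta>) * lap \<phi> \<xi>' \<eta>)) \<le> norm c * (C * A * w)"
      by (rule mult_left_mono) simp
    then show ?thesis by (simp add: I_def norm_mult mult_ac)
  qed
  have f_meas: "(\<lambda>\<eta>. f (tube_pt \<xi> \<eta>)) \<in> borel_measurable borel" if "\<xi> \<in> B" for \<xi>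
  proof -
    have "continuous_on UNIV (\<lambda>\<eta>. (\<lambda>p. f (tube_pt (fst p) (snd p))) (\<xi>, \<eta>))"
      by (rule continuous_on_compose2[OF holomorphic_on_n_tube_continuous[OF f]])
        (use that in \<open>auto intro!: continuous_intros\<close>)
    then show ?thesis by (intro borel_measurable_continuous_onI) simp
  qed
  have pairing_integrable: "integrable lborel (\<lambda>\<eta>. f (tube_pt \<xi> \<eta>) * lap \<phi> \<xi>' \<eta>)"
    if "\<xi> \<in> B" "continuous_on UNIV \<phi>" "\<And>\<eta>. norm (f (tube_pt \<xi> \<eta>) * lap \<phi> \<xi>' \<eta>) \<le> C * wt \<eta>" for \<xi> \<xi>' \<phi> C
    by (rule integrable_le_wt[OF _ that(3)]) (intro borel_measurable_times f_meas that measurable_lap)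
  \<comment> \<open>The parameter X bundles the test function with the real part \<xi>' of its
    transform, so that the constant is uniform in both; \<open>K\<close> holds the real parts used
    in \<open>f\<close>.\<close>
  have DK: "if beurling
      then \<exists>h>0. \<exists>C\<ge>0. \<forall>X A. (case X of (\<phi>, \<xi>') \<Rightarrow> smooth \<phi> \<and> supp \<phi> \<subseteq> K' \<and> DK_bound M h A \<phi> \<and> norm \<xi>' \<le> R) \<longrightarrow>
        (\<forall>\<xi>\<in>K. \<forall>\<eta>. norm (f (tube_pt \<xi> \<eta>) * (case X of (\<phi>, \<xi>') \<Rightarrow> lap \<phi> \<xi>') \<eta>) \<le> C * A * wt \<eta>)
      else \<forall>h>0. \<exists>C\<ge>0. \<forall>X A. (case X of (\<phi>, \<xi>') \<Rightarrow> smooth \<phi> \<and> supp \<phi> \<subseteq> K' \<and> DK_bound M h A \<phi> \<and> norm \<xi>' \<le> R) \<longrightarrow>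
        (\<forall>\<xi>\<in>K. \<forall>\<eta>. norm (f (tube_pt \<xi> \<eta>) * (case X of (\<phi>, \<xi>') \<Rightarrow> lap \<phi> \<xi>') \<eta>) \<le> C * A * wt \<eta>)"
    if K: "compact K" "K \<subseteq> B" and K': "compact K'" and R: "R \<ge> 0" for K K' :: "(real^'n) set" and R :: real
  proof (rule lap_decay_DK[OF M K' R])
    fix H :: real assume H: "H \<ge> 1" and dec: "\<And>h. h > 0 \<Longrightarrow> \<exists>C\<ge>0. \<forall>(k::real) (\<phi>::real^'n::finite \<Rightarrow> complex) \<xi> \<eta> A. 
        0 \<le> k \<longrightarrow> k * CARD('n) * H \<le> h \<longrightarrow> 
        smooth \<phi> \<and> supp \<phi> \<subseteq> K' \<and> DK_bound M h A \<phi> \<and> norm \<xi> \<le> R \<longrightarrow>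
        exp (assoc_fun M (k * norm \<eta>)) * norm (lap \<phi> \<xi> \<eta>) \<le> C * A * wt \<eta>"
    show ?thesis
    proof (rule growth_times_decay[OF H growth[OF K]])
      fix h :: real assume "h > 0"
      from dec[OF this] show "\<exists>C\<ge>0. \<forall>(k::real) X \<eta> A. 0 \<le> k \<longrightarrow> k * CARD('n) * H \<le> h \<longrightarrow> 
          (case X of (\<phi>, \<xi>') \<Rightarrow> smooth \<phi> \<and> supp \<phi> \<subseteq> K' \<and> DK_bound M h A \<phi> \<and> norm \<xi>' \<le> R) \<longrightarrow>
          exp (assoc_fun M (k * norm \<eta>)) * norm ((case X of (\<phi>, \<xi>') \<Rightarrow> lap \<phi> \<xi>') \<eta>) \<le> C * A * wt \<eta>"
        by (simp only: split_paired_All prod.case)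
    qed
  qed
  note DK = DK[unfolded split_paired_All prod.case]
  \<comment> \<open>Each \<open>T\<close> belongs to one \<xi>, so the growth of \<open>f\<close> is
    used on the singleton {\<xi>}.\<close>
  have sig: "if beurling
      then \<exists>m>0. \<exists>C\<ge>0. \<forall>\<phi> A. smooth \<phi> \<and> sigma_bound M m A \<phi> \<longrightarrow>
        (\<forall>\<xi>\<in>{\<xi>}. \<forall>\<eta>. norm (f (tube_pt \<xi> \<eta>) * lap \<phi> 0 \<eta>) \<le> C * A * wt \<eta>)
      else \<forall>m>0. \<exists>C\<ge>0. \<forall>\<phi> A. smooth \<phi> \<and> sigma_bound M m A \<phi> \<longrightarrow>
        (\<forall>\<xi>\<in>{\<xi>}. \<forall>\<eta>. norm (f (tube_pt \<xi> \<eta>) * lap \<phi> 0 \<eta>) \<le> C * A * wt \<eta>)"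
    if "\<xi> \<in> B" for \<xi>
  proof (rule lap_decay_sigma[OF M, where 'n='n])
    fix H :: real assume H: "H \<ge> 1" and dec: "\<And>m. m > 0 \<Longrightarrow> \<exists>C\<ge>0. \<forall>(k::real) (\<phi>::real^'n::finite \<Rightarrow> complex) \<eta> A. 
        0 \<le> k \<longrightarrow> k * CARD('n) * H \<le> m \<longrightarrow> smooth \<phi> \<and> sigma_bound M m A \<phi> \<longrightarrow>
        exp (assoc_fun M (k * norm \<eta>)) * norm (lap \<phi> 0 \<eta>) \<le> C * A * wt \<eta>"
    have K: "compact {\<xi>}" "{\<xi>} \<subseteq> B" using that by auto
    show ?thesis by (rule growth_times_decay[OF H growth[OF K] dec])
  qed
  from False obtain \<xi>0 where \<xi>0: "\<xi>0 \<in> B" by blast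
  \<comment> \<open>For a single \<open>\<phi>\<close> the bound A is absorbed into C. What matters
    is uniformity over \<open>K\<close> and over |\<xi>'| \<le> R, the form in which the contour
    shift uses the estimate.\<close>
  have test_bd: "\<exists>C. \<forall>\<xi>\<in>K. \<forall>\<xi>' \<eta>. norm \<xi>' \<le> R \<longrightarrow> norm (f (tube_pt \<xi> \<eta>) * lap \<phi> \<xi>' \<eta>) \<le> C * wt \<eta>"
    if \<phi>: "\<phi> \<in> test_space beurling M" and K: "compact K" "K \<subseteq> B" and R: "R \<ge> 0" for \<phi> K R
  proof -
    note t = test_spaceD[OF \<phi>]
    show ?thesis
    proof (rule common_parameter[OF DK[OF K t(2) R] t(3)])
      fix h A :: real
      assume A: "DK_bound M h A \<phi>"
        and "\<exists>C\<ge>0. \<forall>\<phi>' \<xi>' A. smooth \<phi>' \<and> supp \<phi>' \<subseteq> supp \<phi> \<and> DK_bound M h A \<phi>' \<and> norm \<xi>' \<le> R \<longrightarrow>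
          (\<forall>\<xi>\<in>K. \<forall>\<eta>. norm (f (tube_pt \<xi> \<eta>) * lap \<phi>' \<xi>' \<eta>) \<le> C * A * wt \<eta>)"
      then obtain C where C: "\<forall>\<phi>' \<xi>' A. smooth \<phi>' \<and> supp \<phi>' \<subseteq> supp \<phi> \<and> DK_bound M h A \<phi>' \<and> norm \<xi>' \<le> R \<longrightarrow>
          (\<forall>\<xi>\<in>K. \<forall>\<eta>. norm (f (tube_pt \<xi> \<eta>) * lap \<phi>' \<xi>' \<eta>) \<le> C * A * wt \<eta>)" by (elim exE conjE)
      show ?thesis
        by (intro exI[of _ "C * A"] ballI allI impI C[rule_format]) (use A t(1) in auto)
    qed
  qed
  define S where "S = I \<xi>0 \<xi>0"
  have S: "ultradistribution beurling M S"
    unfolding ultradistribution_def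
  proof (intro conjI allI impI)
    show "lin_on (test_space beurling M) S"
      unfolding S_def I_def
    proof (rule lin_on_pairing)
      fix \<phi> :: "real^'n \<Rightarrow> complex" assume \<phi>: "\<phi> \<in> test_space beurling M"
      show c: "continuous_on UNIV \<phi>" by (rule smooth_imp_continuous[OF test_spaceD(1)[OF \<phi>]])
      show "integrable lborel (\<lambda>x. exp (x \<bullet> \<xi>0) * norm (\<phi> x))" by (rule integrable_exp_test[OF M \<phi>])
      obtain C where "\<forall>\<xi>\<in>{\<xi>0}. \<forall>\<xi>' \<eta>. norm \<xi>' \<le> norm \<xi>0 \<longrightarrow> norm (f (tube_pt \<xi> \<eta>) * lap \<phi> \<xi>' \<eta>) \<le> C * wt \<eta>"
        using test_bd[OF \<phi>, of "{\<xi>0}" "norm \<xi>0"] \<xi>0 by auto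
      then show "integrable lborel (\<lambda>\<eta>. f (tube_pt \<xi>0 \<eta>) * lap \<phi> \<xi>0 \<eta>)"
        by (intro pairing_integrable[OF \<xi>0 c]) auto
    qed
    fix K :: "(real^'n) set" assume K: "compact K"
    define Q where "Q h \<longleftrightarrow> (\<exists>C. \<forall>\<phi>\<in>test_space beurling M. supp \<phi> \<subseteq> K \<longrightarrow> (\<forall>A. DK_bound M h A \<phi> \<longrightarrow> norm (S \<phi>) \<le> C * A))" for h
    have Q: "Q h" if "\<exists>C\<ge>0. \<forall>\<phi> \<xi>' A. smooth \<phi> \<and> supp \<phi> \<subseteq> K \<and> DK_bound M h A \<phi> \<and> norm \<xi>' \<le> norm \<xi>0 \<longrightarrow>
        (\<forall>\<xi>\<in>{\<xi>0}. \<forall>\<eta>. norm (f (tube_pt \<xi> \<eta>) * lap \<phi> \<xi>' \<eta>) \<le> C * A * wt \<eta>)" for h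
    proof -
      from that obtain C where C: "\<And>\<phi> \<xi>' A \<eta>. smooth \<phi> \<and> supp \<phi> \<subseteq> K \<and> DK_bound M h A \<phi> \<and> norm \<xi>' \<le> norm \<xi>0 \<Longrightarrow>
        norm (f (tube_pt \<xi>0 \<eta>) * lap \<phi> \<xi>' \<eta>) \<le> C * A * wt \<eta>" by blast
      show ?thesis unfolding Q_def S_def
        by (intro exI[of _ "norm c * C * w"] ballI impI allI I_le C) (auto dest: test_spaceD(1))
    qed
    have "compact {\<xi>0}" "{\<xi>0} \<subseteq> B" using \<xi>0 by auto
    from DK[OF this K norm_ge_zero[of \<xi>0]] Q have "if beurling then \<exists>h>0. Q h else \<forall>h>0. Q h"
      by (cases beurling) (simp_all only: if_True if_False, blast+)
    then show "if beurling then \<exists>h>0. \<exists>C. \<forall>\<phi>\<in>test_space beurling M. supp \<phi> \<subseteq> K \<longrightarrow> (\<forall>A. DK_bound M h A \<phi> \<longrightarrow> norm (S \<phi>) \<le> C * A)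
       else \<forall>h>0. \<exists>C. \<forall>\<phi>\<in>test_space beurling M. supp \<phi> \<subseteq> K \<longrightarrow> (\<forall>A. DK_bound M h A \<phi> \<longrightarrow> norm (S \<phi>) \<le> C * A)"
      unfolding Q_def .
  qed
  moreover have "\<exists>T. tempered_ultradistribution beurling M T \<and>
              (\<forall>\<phi>\<in>test_space beurling M.
                  T \<phi> = S (\<lambda>x. complex_of_real (exp (- (x \<bullet> \<xi>))) * \<phi> x)) \<and>
              (\<forall>\<psi>\<in>S_space beurling M.
                  T (fourier \<psi>) = integral\<^sup>L lborel (\<lambda>\<eta>. f (tube_pt \<xi> \<eta>) * \<psi> \<eta>))"
    if \<xi>: "\<xi> \<in> B" for \<xi>
  proof (intro exI[of _ "I \<xi> 0"] conjI ballI)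
    show "tempered_ultradistribution beurling M (I \<xi> 0)"
      unfolding tempered_ultradistribution_def
    proof (intro conjI)
      show "lin_on (S_space beurling M) (I \<xi> 0)"
        unfolding I_def
      proof (rule lin_on_pairing)
        fix \<phi> :: "real^'n \<Rightarrow> complex" assume \<phi>: "\<phi> \<in> S_space beurling M"
        note t = S_spaceD[OF \<phi>]
        show c: "continuous_on UNIV \<phi>" by (rule smooth_imp_continuous[OF t(1)])
        show "integrable lborel (\<lambda>x. exp (x \<bullet> 0) * norm (\<phi> x))" using integrable_S_space(2)[OF \<phi>] by simp
        show "integrable lborel (\<lambda>\<eta>. f (tube_pt \<xi> \<eta>) * lap \<phi> 0 \<eta>)"
        proof (rule common_parameter[OF sig[OF \<xi>] t(2)])
          fix m A :: real
          assume A: "sigma_bound M m A \<phi>"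
            and "\<exists>C\<ge>0. \<forall>\<phi> A. smooth \<phi> \<and> sigma_bound M m A \<phi> \<longrightarrow>
              (\<forall>\<xi>\<in>{\<xi>}. \<forall>\<eta>. norm (f (tube_pt \<xi> \<eta>) * lap \<phi> 0 \<eta>) \<le> C * A * wt \<eta>)"
          then obtain C where C: "\<forall>\<phi> A. smooth \<phi> \<and> sigma_bound M m A \<phi> \<longrightarrow>
              (\<forall>\<xi>\<in>{\<xi>}. \<forall>\<eta>. norm (f (tube_pt \<xi> \<eta>) * lap \<phi> 0 \<eta>) \<le> C * A * wt \<eta>)" by (elim exE conjE)
          show "integrable lborel (\<lambda>\<eta>. f (tube_pt \<xi> \<eta>) * lap \<phi> 0 \<eta>)"
            by (rule pairing_integrable[OF \<xi> c C[rule_format]]) (use A t(1) in auto)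
        qed
      qed
      define Q where "Q m \<longleftrightarrow> (\<exists>C. \<forall>\<phi>\<in>S_space beurling M. \<forall>A. sigma_bound M m A \<phi> \<longrightarrow> norm (I \<xi> 0 \<phi>) \<le> C * A)" for m
      have Q: "Q m" if "\<exists>C\<ge>0. \<forall>\<phi> A. smooth \<phi> \<and> sigma_bound M m A \<phi> \<longrightarrow>
            (\<forall>\<xi>\<in>{\<xi>}. \<forall>\<eta>. norm (f (tube_pt \<xi> \<eta>) * lap \<phi> 0 \<eta>) \<le> C * A * wt \<eta>)" for m
      proof -
        from that obtain C where C: "\<And>\<phi> A \<eta>. smooth \<phi> \<and> sigma_bound M m A \<phi> \<Longrightarrow>
          norm (f (tube_pt \<xi> \<eta>) * lap \<phi> 0 \<eta>) \<le> C * A * wt \<eta>" by blast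
        show ?thesis unfolding Q_def
          by (intro exI[of _ "norm c * C * w"] ballI impI allI I_le C) (auto dest: S_spaceD(1))
      qed
      from sig[OF \<xi>] Q have "if beurling then \<exists>m>0. Q m else \<forall>m>0. Q m"
        by (cases beurling) (simp_all only: if_True if_False, blast+)
      then show "if beurling then \<exists>m>0. \<exists>C. \<forall>\<phi>\<in>S_space beurling M. \<forall>A. sigma_bound M m A \<phi> \<longrightarrow> norm (I \<xi> 0 \<phi>) \<le> C * A
         else \<forall>m>0. \<exists>C. \<forall>\<phi>\<in>S_space beurling M. \<forall>A. sigma_bound M m A \<phi> \<longrightarrow> norm (I \<xi> 0 \<phi>) \<le> C * A"
        unfolding Q_def .
    qed
  next
    fix \<phi> :: "real^'n \<Rightarrow> complex" assume \<phi>: "\<phi> \<in> test_space beurling M"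
    note t = test_spaceD[OF \<phi>]
    \<comment> \<open>The factor e^(-x\<xi>) merges with the kernel, so evaluating the formula for
      \<open>S\<close> on the product gives \<open>I \<xi>0 (\<xi>0 - \<xi>) \<phi>\<close>.\<close>
    have e: "lap (\<lambda>x. complex_of_real (exp (- (x \<bullet> \<xi>))) * \<phi> x) \<xi>0 \<eta> = lap \<phi> (\<xi>0 - \<xi>) \<eta>" for \<eta>
    proof -
      have "exp (of_real (x \<bullet> \<xi>0) + \<i> * of_real (x \<bullet> \<eta>)) * complex_of_real (exp (- (x \<bullet> \<xi>)))
          = exp (complex_of_real (x \<bullet> (\<xi>0 - \<xi>)) + \<i> * of_real (x \<bullet> \<eta>))" for x
        by (simp add: exp_of_real[symmetric] exp_add[symmetric] inner_diff_right algebra_simps)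
      then show ?thesis unfolding lap_def by (simp add: mult.assoc[symmetric])
    qed
    \<comment> \<open>With offset \<open>\<xi>1 = \<xi>\<close>, moving the real part from
      \<open>\<xi>0\<close> to \<xi> brings the argument of the transform to \<xi> - \<xi> = 0,
      where \<open>T\<close> is defined.\<close>
    have "I \<xi>0 (\<xi>0 - \<xi>) \<phi> = I \<xi> (\<xi> - \<xi>) \<phi>"
      unfolding I_def
      by (subst integral_tube_independent[OF assms(2,3) f smooth_imp_continuous[OF t(1)] t(2) test_bd[OF \<phi>] \<xi>0 \<xi>]) auto
    then show "I \<xi> 0 \<phi> = S (\<lambda>x. complex_of_real (exp (- (x \<bullet> \<xi>))) * \<phi> x)"
      by (auto simp: S_def I_def e)
  next
    fix \<psi> :: "real^'n \<Rightarrow> complex" assume \<psi>: "\<psi> \<in> S_space beurling M"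
    \<comment> \<open>\<open>T\<close> is a formula that can be evaluated at
      \<open>fourier \<psi>\<close> directly: inversion under the integral sign restores
      \<open>\<psi>\<close>, and \<open>c\<close> cancels the power of 2 pi.\<close>
    have "I \<xi> 0 (fourier \<psi>) = c * integral\<^sup>L lborel (\<lambda>\<eta>. of_real ((2 * pi) ^ CARD('n)) * (f (tube_pt \<xi> \<eta>) * \<psi> \<eta>))"
      unfolding I_def lap_fourier[OF M \<psi>] by (simp only: mult.left_commute)
    also have "\<dots> = (c * of_real ((2 * pi) ^ CARD('n))) * integral\<^sup>L lborel (\<lambda>\<eta>. f (tube_pt \<xi> \<eta>) * \<psi> \<eta>)"
      unfolding integral_mult_right_zero by (simp only: mult.assoc)
    also have "c * of_real ((2 * pi) ^ CARD('n)) = 1"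
      unfolding c_def of_real_mult[symmetric] by simp
    finally show "I \<xi> 0 (fourier \<psi>) = integral\<^sup>L lborel (\<lambda>\<eta>. f (tube_pt \<xi> \<eta>) * \<psi> \<eta>)" by simp
  qed
  ultimately show ?thesis by blast
qed

end
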